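(* Let $G$ be a locally compact Hausdorff topological group, let $X$ be a nonempty locally compact Hausdorff space with a proper $G$-action, let $n\in\mathbb N$, and let $\chi\colon G\to\mathbb R$ be a character. Then $\chi\in\Sigma^n_{\mathrm{top}}(G)$ if and only if the filtration $$(G_\chi\cdot\mathrm E K)_{K\in\mathcal C(X)}$$ of $\mathrm E X$ is essentially $(n-1)$-connected.
   Context: $\mathbb N$ contains $0$. A character on $G$ is a continuous homomorphism $\chi\colon G\to\mathbb R$; $G_\chi:=\{g\in G\mid\chi(g)\ge0\}$. Actions are continuous; an action $G\times X\to X$ is proper if the map $G\times X\to X\times X$, $(g,x)\mapsto(x,g\cdot x)$, is proper (preimages of compact sets are compact). For a set $S$, $\mathrm E S$ is the simplicial set with $n$-simplices $S^{n+1}$, the $i$-th face (degeneracy) map deleting (doubling) the $i$-th entry. For a topological space $X$, $\mathcal C(X)$ is the poset of compact subsets of $X$ ordered by inclusion. If $G$ acts on $X$ and $K\in\mathcal C(X)$, $G_\chi\cdot\mathrm E K\subseteq \mathrm E X$ is the simplicial subset of all simplices $(g\cdot x_0,\dots,g\cdot x_k)$ with $g\in G_\chi$, $x_i\in K$. This applies in particular to $X=G$ with the left multiplication action. A filtration $(X_\alpha)_{\alpha\in A}$ of a connected simplicial set over a directed poset $A$ (simplicial subsets, increasing in $\alpha$, with union the whole) is essentially $n$-connected if for a vertex $x$ (the choice is immaterial), every $k$ with $0\le k\le n$ and every $\alpha$ with $x\in X_\alpha$, there is $\beta\ge\alpha$ such that $\pi_k(X_\alpha,x)\to\pi_k(X_\beta,x)$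 is trivial (homotopy groups are those of geometric realizations); essentially $(-1)$-connected is a vacuous condition. $\Sigma^n_{\mathrm{top}}(G)$ is the set of characters $\chi$ for which the filtration $(G_\chi\cdot \mathrm E C)_{C\in\mathcal C(G)}$ of $\mathrm E G$ is essentially $(n-1)$-connected. *)

theory Defs
  imports "HOL-Analysis.Analysis" "HOL-Homology.Homology" "HOL-Algebra.Group_Action"
begin

section \<open>Simplicial sets\<close>

text \<open>\<open>face X n i\<close> is the \<open>i\<close>-th face map from \<open>n\<close>-simplices to \<open>(n - 1)\<close>-simplices
  (relevant for \<open>1 \<le> n\<close>, \<open>i \<le> n\<close>), and \<open>degen X n i\<close> the \<open>i\<close>-th degeneracy map from
  \<open>n\<close>-simplices to \<open>(n + 1)\<close>-simplices (\<open>i \<le> n\<close>).\<close>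

record 'a sset =
  simplices :: "nat \<Rightarrow> 'a set"
  face :: "nat \<Rightarrow> nat \<Rightarrow> 'a \<Rightarrow> 'a"
  degen :: "nat \<Rightarrow> nat \<Rightarrow> 'a \<Rightarrow> 'a"

definition simplicial_set :: "'a sset \<Rightarrow> bool" where
  "simplicial_set X \<longleftrightarrow>
    (\<forall>n. \<forall>i\<le>Suc n. \<forall>x\<in>simplices X (Suc n). face X (Suc n) i x \<in> simplices X n) \<and>
    (\<forall>n. \<forall>i\<le>n. \<forall>x\<in>simplices X n. degen X n i x \<in> simplices X (Suc n)) \<and>
    (\<forall>n i j. \<forall>x\<in>simplices X (Suc (Suc n)). i < j \<and> j \<le> Suc (Suc n) \<longrightarrow>
       face X (Suc n) i (face X (Suc (Suc n)) j x) =
       face X (Suc n) (j - 1) (face X (Suc (Suc n)) i x)) \<and>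
    (\<forall>n i j. \<forall>x\<in>simplices X (Suc n). i < j \<and> j \<le> Suc n \<longrightarrow>
       face X (Suc (Suc n)) i (degen X (Suc n) j x) =
       degen X n (j - 1) (face X (Suc n) i x)) \<and>
    (\<forall>n j. \<forall>x\<in>simplices X n. j \<le> n \<longrightarrow>
       face X (Suc n) j (degen X n j x) = x \<and>
       face X (Suc n) (Suc j) (degen X n j x) = x) \<and>
    (\<forall>n i j. \<forall>x\<in>simplices X (Suc n). Suc j < i \<and> i \<le> Suc (Suc n) \<longrightarrow>
       face X (Suc (Suc n)) i (degen X (Suc n) j x) =
       degen X n j (face X (Suc n) (i - 1) x)) \<and>
    (\<forall>n i j. \<forall>x\<in>simplices X n. i \<le> j \<and> j \<le> n \<longrightarrow>
       degen X (Suc n) i (degen X n j x) = degen X (Suc n) (Suc j) (degen X n i x))"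

definition simplicial_subset :: "'a sset \<Rightarrow> 'a sset \<Rightarrow> bool" where
  "simplicial_subset Y X \<longleftrightarrow>
    simplicial_set Y \<and> simplicial_set X \<and> (\<forall>n. simplices Y n \<subseteq> simplices X n) \<and>
    (\<forall>n. \<forall>i\<le>Suc n. \<forall>y\<in>simplices Y (Suc n). face Y (Suc n) i y = face X (Suc n) i y) \<and>
    (\<forall>n. \<forall>i\<le>n. \<forall>y\<in>simplices Y n. degen Y n i y = degen X n i y)"


section \<open>Geometric realization\<close>

definition quotient_topology :: "'a topology \<Rightarrow> ('a \<times> 'a) set \<Rightarrow> 'a set topology" where
  "quotient_topology T R =
    topology (\<lambda>U. U \<subseteq> topspace T // R \<and> openin T {p \<in> topspace T. R `` {p} \<in> U})"

lemma istopology_quotient: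
  "istopology (\<lambda>U. U \<subseteq> topspace T // R \<and> openin T {p \<in> topspace T. R `` {p} \<in> U})"
proof -
  have 1: "{p \<in> topspace T. R `` {p} \<in> U \<inter> V} =
      {p \<in> topspace T. R `` {p} \<in> U} \<inter> {p \<in> topspace T. R `` {p} \<in> V}" for U V
    by auto
  have 2: "{p \<in> topspace T. R `` {p} \<in> \<Union>\<K>} = (\<Union>U\<in>\<K>. {p \<in> topspace T. R `` {p} \<in> U})" for \<K>
    by auto
  show ?thesis
    unfolding istopology_def 1 2 by blast
qed

lemma openin_quotient_topology:
  "openin (quotient_topology T R) U \<longleftrightarrow>
    U \<subseteq> topspace T // R \<and> openin T {p \<in> topspace T. R `` {p} \<in> U}"
  by (simp add: quotient_topology_def istopology_quotient topology_inverse')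

lemma topspace_quotient_topology [simp]:
  "topspace (quotient_topology T R) = topspace T // R"
proof
  show "topspace (quotient_topology T R) \<subseteq> topspace T // R"
    by (meson openin_quotient_topology openin_topspace)
  have "{p \<in> topspace T. R `` {p} \<in> topspace T // R} = topspace T"
    by (auto intro: quotientI)
  then have "openin (quotient_topology T R) (topspace T // R)"
    by (simp add: openin_quotient_topology)
  then show "topspace T // R \<subseteq> topspace (quotient_topology T R)"
    by (rule openin_subset)
qed

lemma quotient_map_quotient_topology:
  "quotient_map T (quotient_topology T R) (\<lambda>p. R `` {p})"
  by (auto simp: quotient_map_def openin_quotient_topology quotient_def)

text \<open>The coface maps of the standard simplices are the library's
  \<^const>\<open>simplical_face\<close>. The codegeneracy from the \<open>(n + 1)\<close>- to the \<open>n\<close>-simplex adds the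
  coordinates \<open>i\<close> and \<open>i + 1\<close>.\<close>

definition codegeneracy :: "nat \<Rightarrow> (nat \<Rightarrow> real) \<Rightarrow> nat \<Rightarrow> real" where
  "codegeneracy i t = (\<lambda>j. if j < i then t j else if j = i then t i + t (Suc i) else t (Suc j))"

definition prerealization :: "'a sset \<Rightarrow> ((nat \<times> 'a) \<times> (nat \<Rightarrow> real)) topology" where
  "prerealization X =
    sum_topology (\<lambda>(n, x). subtopology (powertop_real UNIV) (standard_simplex n))
      {(n, x). x \<in> simplices X n}"

inductive_set realization_rel ::
  "'a sset \<Rightarrow> (((nat \<times> 'a) \<times> (nat \<Rightarrow> real)) \<times> ((nat \<times> 'a) \<times> (nat \<Rightarrow> real))) set"
  for X where
    refl: "x \<in> simplices X n \<Longrightarrow> t \<in> standard_simplex n \<Longrightarrow>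
      (((n, x), t), ((n, x), t)) \<in> realization_rel X"
  | face: "x \<in> simplices X (Suc n) \<Longrightarrow> i \<le> Suc n \<Longrightarrow> t \<in> standard_simplex n \<Longrightarrow>
      (((n, face X (Suc n) i x), t), ((Suc n, x), simplical_face i t)) \<in> realization_rel X"
  | degen: "x \<in> simplices X n \<Longrightarrow> i \<le> n \<Longrightarrow> t \<in> standard_simplex (Suc n) \<Longrightarrow>
      (((Suc n, degen X n i x), t), ((n, x), codegeneracy i t)) \<in> realization_rel X"
  | sym: "(p, q) \<in> realization_rel X \<Longrightarrow> (q, p) \<in> realization_rel X"
  | trans: "(p, q) \<in> realization_rel X \<Longrightarrow> (q, r) \<in> realization_rel X \<Longrightarrow>
      (p, r) \<in> realization_rel X"

definition realization :: "'a sset \<Rightarrow> ((nat \<times> 'a) \<times> (nat \<Rightarrow> real)) set topology" where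
  "realization X = quotient_topology (prerealization X) (realization_rel X)"

definition vertex_point :: "'a sset \<Rightarrow> 'a \<Rightarrow> ((nat \<times> 'a) \<times> (nat \<Rightarrow> real)) set" where
  "vertex_point X v = realization_rel X `` {((0, v), \<lambda>j. if j = 0 then 1 else 0)}"

text \<open>For a simplicial subset \<open>Y\<close> of \<open>X\<close>, the map from \<open>|Y|\<close> to \<open>|X|\<close> induced by the inclusion:
  it sends the class of a point with respect to \<open>Y\<close> to its class with respect to \<open>X\<close>.\<close>

definition realization_incl ::
  "'a sset \<Rightarrow> ((nat \<times> 'a) \<times> (nat \<Rightarrow> real)) set \<Rightarrow> ((nat \<times> 'a) \<times> (nat \<Rightarrow> real)) set" where
  "realization_incl X c = realization_rel X `` c"


section \<open>Homotopy groups\<close>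

definition cube :: "nat \<Rightarrow> (nat \<Rightarrow> real) set" where
  "cube k = {t. (\<forall>i<k. 0 \<le> t i \<and> t i \<le> 1) \<and> (\<forall>i\<ge>k. t i = 0)}"

definition cube_boundary :: "nat \<Rightarrow> (nat \<Rightarrow> real) set" where
  "cube_boundary k = {t \<in> cube k. \<exists>i<k. t i = 0 \<or> t i = 1}"

definition cube_topology :: "nat \<Rightarrow> (nat \<Rightarrow> real) topology" where
  "cube_topology k = subtopology (powertop_real UNIV) (cube k)"

definition spheroids :: "nat \<Rightarrow> 'b topology \<Rightarrow> 'b \<Rightarrow> ((nat \<Rightarrow> real) \<Rightarrow> 'b) set" where
  "spheroids k Y y = {f. continuous_map (cube_topology k) Y f \<and> f ` cube_boundary k \<subseteq> {y}}"

definition spheroid_class ::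
  "nat \<Rightarrow> 'b topology \<Rightarrow> 'b \<Rightarrow> ((nat \<Rightarrow> real) \<Rightarrow> 'b) \<Rightarrow> ((nat \<Rightarrow> real) \<Rightarrow> 'b) set" where
  "spheroid_class k Y y f =
    {g. homotopic_with (\<lambda>h. h ` cube_boundary k \<subseteq> {y}) (cube_topology k) Y f g}"

text \<open>The underlying pointed set of \<open>\<pi>\<^sub>k(Y, y)\<close>; for \<open>k = 0\<close> the cube is a point with empty
  boundary and one obtains the set of path components. The group structure (\<open>k \<ge> 1\<close>) plays no
  role for the triviality of an induced map, only the neutral element \<open>homotopy_one\<close> does.\<close>

definition homotopy_group ::
  "nat \<Rightarrow> 'b topology \<Rightarrow> 'b \<Rightarrow> ((nat \<Rightarrow> real) \<Rightarrow> 'b) set set" where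
  "homotopy_group k Y y = spheroid_class k Y y ` spheroids k Y y"

definition homotopy_one ::
  "nat \<Rightarrow> 'b topology \<Rightarrow> 'b \<Rightarrow> ((nat \<Rightarrow> real) \<Rightarrow> 'b) set" where
  "homotopy_one k Y y = spheroid_class k Y y (\<lambda>t. y)"

definition homotopy_induced ::
  "nat \<Rightarrow> 'c topology \<Rightarrow> 'c \<Rightarrow> ('b \<Rightarrow> 'c) \<Rightarrow>
    ((nat \<Rightarrow> real) \<Rightarrow> 'b) set \<Rightarrow> ((nat \<Rightarrow> real) \<Rightarrow> 'c) set" where
  "homotopy_induced k Z z \<phi> c = (\<Union>f\<in>c. spheroid_class k Z z (\<phi> \<circ> f))"


section \<open>Filtrations and essential connectedness\<close>

definition connected_sset :: "'a sset \<Rightarrow> bool" where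
  "connected_sset X \<longleftrightarrow> simplices X 0 \<noteq> {} \<and> connected_space (realization X)"

definition filtration :: "'i::order set \<Rightarrow> ('i \<Rightarrow> 'a sset) \<Rightarrow> 'a sset \<Rightarrow> bool" where
  "filtration A F X \<longleftrightarrow>
    A \<noteq> {} \<and> (\<forall>\<alpha>\<in>A. \<forall>\<beta>\<in>A. \<exists>\<gamma>\<in>A. \<alpha> \<le> \<gamma> \<and> \<beta> \<le> \<gamma>) \<and>
    (\<forall>\<alpha>\<in>A. simplicial_subset (F \<alpha>) X) \<and>
    (\<forall>\<alpha>\<in>A. \<forall>\<beta>\<in>A. \<alpha> \<le> \<beta> \<longrightarrow> simplicial_subset (F \<alpha>) (F \<beta>)) \<and>
    (\<forall>n. simplices X n = (\<Union>\<alpha>\<in>A. simplices (F \<alpha>) n))"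

text \<open>The level \<open>n\<close> is an integer: for \<open>n = -1\<close> no \<open>k\<close> is admissible. The first two conjuncts are
  standing assumptions; they are proved below for the filtrations of interest. The base vertex
  is existentially quantified (for \<open>n \<ge> 0\<close> its choice is immaterial).\<close>

definition essentially_connected ::
  "int \<Rightarrow> 'i::order set \<Rightarrow> ('i \<Rightarrow> 'a sset) \<Rightarrow> 'a sset \<Rightarrow> bool" where
  "essentially_connected n A F X \<longleftrightarrow>
    connected_sset X \<and> filtration A F X \<and>
    (\<exists>x\<in>simplices X 0. \<forall>k::nat. int k \<le> n \<longrightarrow>
      (\<forall>\<alpha>\<in>A. x \<in> simplices (F \<alpha>) 0 \<longrightarrow>
        (\<exists>\<beta>\<in>A. \<alpha> \<le> \<beta> \<and>
          (\<forall>c\<in>homotopy_group k (realization (F \<alpha>)) (vertex_point (F \<alpha>) x).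
            homotopy_induced k (realization (F \<beta>)) (vertex_point (F \<beta>) x)
              (realization_incl (F \<beta>)) c =
            homotopy_one k (realization (F \<beta>)) (vertex_point (F \<beta>) x)))))"


section \<open>Topological groups, characters and proper actions\<close>

locale topological_group = group G for G (structure) +
  fixes T :: "'a topology"
  assumes topspace_eq: "topspace T = carrier G"
    and continuous_mult: "continuous_map (prod_topology T T) T (\<lambda>(x, y). x \<otimes> y)"
    and continuous_inv: "continuous_map T T (\<lambda>x. inv x)"

definition is_character :: "('g, 'm) monoid_scheme \<Rightarrow> 'g topology \<Rightarrow> ('g \<Rightarrow> real) \<Rightarrow> bool" where
  "is_character G T chi \<longleftrightarrow>
    continuous_map T euclideanreal chi \<and>
    (\<forall>g\<in>carrier G. \<forall>h\<in>carrier G. chi (g \<otimes>\<^bsub>G\<^esub> h) = chi g + chi h)"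

definition nonneg_part :: "('g, 'm) monoid_scheme \<Rightarrow> ('g \<Rightarrow> real) \<Rightarrow> 'g set" where
  "nonneg_part G chi = {g \<in> carrier G. 0 \<le> chi g}"

definition continuous_action ::
  "('g, 'm) monoid_scheme \<Rightarrow> 'g topology \<Rightarrow> 'x topology \<Rightarrow> ('g \<Rightarrow> 'x \<Rightarrow> 'x) \<Rightarrow> bool" where
  "continuous_action G T X \<phi> \<longleftrightarrow>
    group_action G (topspace X) \<phi> \<and>
    continuous_map (prod_topology T X) X (\<lambda>(g, x). \<phi> g x)"

definition proper_action ::
  "('g, 'm) monoid_scheme \<Rightarrow> 'g topology \<Rightarrow> 'x topology \<Rightarrow> ('g \<Rightarrow> 'x \<Rightarrow> 'x) \<Rightarrow> bool" where
  "proper_action G T X \<phi> \<longleftrightarrow>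
    continuous_action G T X \<phi> \<and>
    (\<forall>C. compactin (prod_topology X X) C \<longrightarrow>
      compactin (prod_topology T X)
        {(g, x). g \<in> topspace T \<and> x \<in> topspace X \<and> (x, \<phi> g x) \<in> C})"

text \<open>The restriction makes each translation extensional, as \<^locale>\<open>group_action\<close> requires.\<close>

definition left_mult :: "('g, 'm) monoid_scheme \<Rightarrow> 'g \<Rightarrow> 'g \<Rightarrow> 'g" where
  "left_mult G g = (\<lambda>h\<in>carrier G. g \<otimes>\<^bsub>G\<^esub> h)"


section \<open>The simplicial set E S, its filtration, and the Sigma-sets\<close>

text \<open>An \<open>n\<close>-simplex is a list of length \<open>n + 1\<close>.\<close>

definition E_sset :: "'a set \<Rightarrow> 'a list sset" where
  "E_sset S = \<lparr>simplices = (\<lambda>n. {xs. length xs = Suc n \<and> set xs \<subseteq> S}),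
     face = (\<lambda>n i xs. take i xs @ drop (Suc i) xs),
     degen = (\<lambda>n i xs. take (Suc i) xs @ drop i xs)\<rparr>"

definition translates :: "'g set \<Rightarrow> ('g \<Rightarrow> 'x \<Rightarrow> 'x) \<Rightarrow> 'x sset \<Rightarrow> 'x sset" where
  "translates H \<phi> Y = Y\<lparr>simplices := (\<lambda>n. {\<phi> g x | g x. g \<in> H \<and> x \<in> simplices Y n})\<rparr>"

text \<open>The simplicial subset \<open>nonneg_part G chi \<cdot> E K\<close>: \<open>g\<close> acts on simplices entrywise.\<close>

definition chi_sset ::
  "('g, 'm) monoid_scheme \<Rightarrow> ('g \<Rightarrow> real) \<Rightarrow> ('g \<Rightarrow> 'x \<Rightarrow> 'x) \<Rightarrow> 'x set \<Rightarrow> 'x list sset" where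
  "chi_sset G chi \<phi> K = translates (nonneg_part G chi) (\<lambda>g. map (\<phi> g)) (E_sset K)"

definition compacts :: "'x topology \<Rightarrow> 'x set set" where
  "compacts X = {K. compactin X K}"

definition Sigma_top :: "('g, 'm) monoid_scheme \<Rightarrow> 'g topology \<Rightarrow> nat \<Rightarrow> ('g \<Rightarrow> real) set" where
  "Sigma_top G T n =
    {chi. is_character G T chi \<and>
      essentially_connected (int n - 1) (compacts T)
        (chi_sset G chi (left_mult G)) (E_sset (carrier G))}"


text \<open>The two standing assumptions in \<open>essentially_connected\<close> hold for these filtrations.\<close>

lemma face_list_simplex:
  assumes "length xs = Suc (Suc n)" "set xs \<subseteq> S" "i \<le> Suc n"
  shows "length (take i xs @ drop (Suc i) xs) = Suc n \<and> set (take i xs @ drop (Suc i) xs) \<subseteq> S"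
  using assms set_take_subset[of i xs] set_drop_subset[of "Suc i" xs] by auto

lemma degen_list_simplex:
  assumes "length xs = Suc n" "set xs \<subseteq> S" "i \<le> n"
  shows "length (take (Suc i) xs @ drop i xs) = Suc (Suc n) \<and>
    set (take (Suc i) xs @ drop i xs) \<subseteq> S"
  using assms set_take_subset[of "Suc i" xs] set_drop_subset[of i xs] by auto

lemma nth_face_list:
  assumes "i < length xs" "k < length xs - 1"
  shows "(take i xs @ drop (Suc i) xs) ! k = xs ! (if k < i then k else Suc k)"
  using assms by (auto simp: nth_append)

lemma nth_degen_list:
  assumes "i < length xs" "k < Suc (length xs)"
  shows "(take (Suc i) xs @ drop i xs) ! k = xs ! (if k \<le> i then k else k - 1)"
  using assms by (auto simp: nth_append intro: arg_cong[where f = "(!) xs"])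

lemma simplicial_set_E_sset: "simplicial_set (E_sset S)"
proof -
  define d where "d = (\<lambda>i (xs::'a list). take i xs @ drop (Suc i) xs)"
  define s where "s = (\<lambda>i (xs::'a list). take (Suc i) xs @ drop i xs)"
  have len [simp]: "i < length xs \<Longrightarrow> length (d i xs) = length xs - 1"
      "i < length xs \<Longrightarrow> length (s i xs) = Suc (length xs)" for i and xs :: "'a list"
    by (auto simp: d_def s_def)
  have nth: "i < length xs \<Longrightarrow> k < length xs - 1 \<Longrightarrow> d i xs ! k = xs ! (if k < i then k else Suc k)"
      "i < length xs \<Longrightarrow> k < Suc (length xs) \<Longrightarrow> s i xs ! k = xs ! (if k \<le> i then k else k - 1)"
    for i k and xs :: "'a list"
    unfolding d_def s_def by (simp_all only: nth_face_list nth_degen_list)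
  have dd: "d i (d j xs) = d (j - 1) (d i xs)" if "i < j" "j < length xs"
    for i j and xs :: "'a list"
    by (rule nth_equalityI) (use that in \<open>auto simp: nth\<close>)
  have ds1: "d i (s j xs) = s (j - 1) (d i xs)" if "i < j" "j < length xs"
    for i j and xs :: "'a list"
    by (rule nth_equalityI) (use that in \<open>auto simp: nth\<close>)
  have ds2: "d j (s j xs) = xs" "d (Suc j) (s j xs) = xs" if "j < length xs"
    for j and xs :: "'a list"
    by (rule nth_equalityI; use that in \<open>auto simp: nth\<close>)+
  have ds3: "d i (s j xs) = s j (d (i - 1) xs)" if "Suc j < i" "i \<le> length xs"
    for i j and xs :: "'a list"
    by (rule nth_equalityI) (use that in \<open>auto simp: nth\<close>)
  have ss: "s i (s j xs) = s (Suc j) (s i xs)" if "i \<le> j" "j < length xs"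
    for i j and xs :: "'a list"
    by (rule nth_equalityI) (use that in \<open>auto simp: nth\<close>)
  have E: "E_sset S = \<lparr>simplices = (\<lambda>n. {xs. length xs = Suc n \<and> set xs \<subseteq> S}),
     face = (\<lambda>n. d), degen = (\<lambda>n. s)\<rparr>"
    by (simp add: E_sset_def d_def s_def)
  have c: "length xs = Suc (Suc n) \<Longrightarrow> set xs \<subseteq> S \<Longrightarrow> i \<le> Suc n \<Longrightarrow> set (d i xs) \<subseteq> S"
    "length xs = Suc n \<Longrightarrow> set xs \<subseteq> S \<Longrightarrow> i \<le> n \<Longrightarrow> set (s i xs) \<subseteq> S" for n i xs
    using face_list_simplex[of xs n S i] degen_list_simplex[of xs n S i]
    by (auto simp: d_def s_def)
  show ?thesis
    unfolding simplicial_set_def E sset.simps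
    by (intro conjI allI ballI impI; (elim conjE CollectE)?; (intro CollectI conjI)?)
      (simp_all add: c dd ds1 ds2 ds3 ss)
qed

lemma simplices_chi_sset:
  "simplices (chi_sset G chi \<phi> K) n =
    {map (\<phi> g) xs | g xs. g \<in> nonneg_part G chi \<and> length xs = Suc n \<and> set xs \<subseteq> K}"
  by (auto simp: chi_sset_def translates_def E_sset_def)

lemma face_chi_sset: "face (chi_sset G chi \<phi> K) n i xs = take i xs @ drop (Suc i) xs"
  and degen_chi_sset: "degen (chi_sset G chi \<phi> K) n i xs = take (Suc i) xs @ drop i xs"
  by (auto simp: chi_sset_def translates_def E_sset_def)

lemma simplicial_set_closed_subset:
  assumes X: "simplicial_set X" and sub: "\<And>n. simplices Y n \<subseteq> simplices X n"
    and "face Y = face X" "degen Y = degen X"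
    and "\<And>n i y. i \<le> Suc n \<Longrightarrow> y \<in> simplices Y (Suc n) \<Longrightarrow> face X (Suc n) i y \<in> simplices Y n"
    and "\<And>n i y. i \<le> n \<Longrightarrow> y \<in> simplices Y n \<Longrightarrow> degen X n i y \<in> simplices Y (Suc n)"
  shows "simplicial_set Y"
  using X assms(5,6) unfolding simplicial_set_def assms(3,4)
  by (elim conjE, intro conjI allI ballI impI) (frule subsetD[OF sub], simp)+

lemma simplicial_set_chi_sset:
  assumes "\<And>g x. g \<in> nonneg_part G chi \<Longrightarrow> x \<in> K \<Longrightarrow> \<phi> g x \<in> S"
  shows "simplicial_set (chi_sset G chi \<phi> K)"
    and "simplicial_subset (chi_sset G chi \<phi> K) (E_sset S)"
proof -
  have eq: "face (chi_sset G chi \<phi> K) = face (E_sset S)" "degen (chi_sset G chi \<phi> K) = degen (E_sset S)"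
    by (auto simp: chi_sset_def translates_def E_sset_def)
  have sub: "simplices (chi_sset G chi \<phi> K) n \<subseteq> simplices (E_sset S) n" for n
    using assms by (fastforce simp: simplices_chi_sset E_sset_def)
  have 1: "face (E_sset S) (Suc n) i y \<in> simplices (chi_sset G chi \<phi> K) n"
    if i: "i \<le> Suc n" and y: "y \<in> simplices (chi_sset G chi \<phi> K) (Suc n)" for n i y
  proof -
    obtain g xs where g: "g \<in> nonneg_part G chi" "length xs = Suc (Suc n)" "set xs \<subseteq> K"
      and y_eq: "y = map (\<phi> g) xs"
      using y unfolding simplices_chi_sset by blast
    have "face (E_sset S) (Suc n) i y = map (\<phi> g) (take i xs @ drop (Suc i) xs)"
      by (simp add: y_eq E_sset_def take_map drop_map)
    then show ?thesis
      using g face_list_simplex[OF g(2,3) i] unfolding simplices_chi_sset by blast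
  qed
  have 2: "degen (E_sset S) n i y \<in> simplices (chi_sset G chi \<phi> K) (Suc n)"
    if i: "i \<le> n" and y: "y \<in> simplices (chi_sset G chi \<phi> K) n" for n i y
  proof -
    obtain g xs where g: "g \<in> nonneg_part G chi" "length xs = Suc n" "set xs \<subseteq> K"
      and y_eq: "y = map (\<phi> g) xs"
      using y unfolding simplices_chi_sset by blast
    have "degen (E_sset S) n i y = map (\<phi> g) (take (Suc i) xs @ drop i xs)"
      by (simp add: y_eq E_sset_def take_map drop_map)
    then show ?thesis
      using g degen_list_simplex[OF g(2,3) i] unfolding simplices_chi_sset by blast
  qed
  show "simplicial_set (chi_sset G chi \<phi> K)"
    using simplicial_set_closed_subset[OF simplicial_set_E_sset sub eq 1 2] .
  then show "simplicial_subset (chi_sset G chi \<phi> K) (E_sset S)"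
    unfolding simplicial_subset_def using simplicial_set_E_sset sub eq by auto
qed

lemma filtration_chi_sset:
  assumes act: "group_action G (topspace X) \<phi>" and chi: "is_character G T chi"
  shows "filtration (compacts X) (chi_sset G chi \<phi>) (E_sset (topspace X))"
proof -
  interpret group_action G "topspace X" \<phi> by (rule act)
  interpret group G using group_hom by (simp add: group_hom_def)
  have "chi (\<one>\<^bsub>G\<^esub> \<otimes>\<^bsub>G\<^esub> \<one>\<^bsub>G\<^esub>) = chi \<one>\<^bsub>G\<^esub> + chi \<one>\<^bsub>G\<^esub>"
    using chi one_closed unfolding is_character_def by blast
  then have one: "\<one>\<^bsub>G\<^esub> \<in> nonneg_part G chi"
    by (simp add: nonneg_part_def)
  have mem: "\<phi> g x \<in> topspace X" if "K \<in> compacts X" "g \<in> nonneg_part G chi" "x \<in> K" for K g x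
    using that element_image[of g x "\<phi> g x"] compactin_subset_topspace[of X K]
    by (auto simp: compacts_def nonneg_part_def)
  have sub: "simplicial_subset (chi_sset G chi \<phi> K) (E_sset (topspace X))" if "K \<in> compacts X" for K
    using mem that by (intro simplicial_set_chi_sset) auto
  have "xs \<in> (\<Union>K\<in>compacts X. simplices (chi_sset G chi \<phi> K) n)"
    if "xs \<in> simplices (E_sset (topspace X)) n" for n xs
  proof
    have xs: "length xs = Suc n" "set xs \<subseteq> topspace X"
      using that by (auto simp: E_sset_def)
    show "set xs \<in> compacts X"
      using xs by (simp add: compacts_def finite_imp_compactin)
    have "map (\<phi> \<one>\<^bsub>G\<^esub>) xs = xs"
      using xs id_eq_one by (intro map_idI) (metis restrict_apply' subsetD)
    then show "xs \<in> simplices (chi_sset G chi \<phi> (set xs)) n"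
      unfolding simplices_chi_sset using one xs(1) by force
  qed
  moreover have "simplices (chi_sset G chi \<phi> K) n \<subseteq> simplices (E_sset (topspace X)) n"
    if "K \<in> compacts X" for K n
    using sub[OF that] by (simp add: simplicial_subset_def)
  ultimately have "simplices (E_sset (topspace X)) n =
      (\<Union>K\<in>compacts X. simplices (chi_sset G chi \<phi> K) n)" for n
    by blast
  moreover have "simplicial_subset (chi_sset G chi \<phi> K) (chi_sset G chi \<phi> L)"
    if "K \<in> compacts X" "L \<in> compacts X" "K \<subseteq> L" for K L
  proof -
    have "simplices (chi_sset G chi \<phi> K) n \<subseteq> simplices (chi_sset G chi \<phi> L) n" for n
      using that(3) unfolding simplices_chi_sset by blast
    then show ?thesis
      using sub[OF that(1)] sub[OF that(2)]
      by (simp add: simplicial_subset_def face_chi_sset degen_chi_sset)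
  qed
  moreover have "{} \<in> compacts X" "\<And>K L. K \<in> compacts X \<Longrightarrow> L \<in> compacts X \<Longrightarrow> K \<union> L \<in> compacts X"
    by (auto simp: compacts_def compactin_Un)
  ultimately show ?thesis
    unfolding filtration_def using sub by (metis empty_iff sup_ge1 sup_ge2)
qed

lemma group_action_left_mult:
  assumes "group G"
  shows "group_action G (carrier G) (left_mult G)"
proof -
  interpret group G by (rule assms)
  have inj: "inj_on (left_mult G g) (carrier G)" if "g \<in> carrier G" for g
    using that by (auto simp: inj_on_def left_mult_def)
  have surj: "left_mult G g ` carrier G = carrier G" if "g \<in> carrier G" for g
  proof -
    have "h = left_mult G g (inv\<^bsub>G\<^esub> g \<otimes>\<^bsub>G\<^esub> h)" if "h \<in> carrier G" for h
      using that \<open>g \<in> carrier G\<close> by (simp add: left_mult_def flip: m_assoc)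
    then show ?thesis
      using \<open>g \<in> carrier G\<close> by (auto simp: left_mult_def image_iff intro!: bexI)
  qed
  have bij: "left_mult G g \<in> Bij (carrier G)" if "g \<in> carrier G" for g
    using inj[OF that] surj[OF that] by (simp add: Bij_def bij_betw_def left_mult_def)
  have "left_mult G (g \<otimes>\<^bsub>G\<^esub> h) = compose (carrier G) (left_mult G g) (left_mult G h)"
    if "g \<in> carrier G" "h \<in> carrier G" for g h
    using that by (auto simp: left_mult_def compose_def m_assoc intro!: restrict_ext)
  then have "left_mult G \<in> hom G (BijGroup (carrier G))"
    using bij by (auto simp: hom_def BijGroup_def)
  then show ?thesis
    by (simp add: group_action_def group_hom_def group_hom_axioms_def group_BijGroup assms)
qed

lemma topspace_prerealization:
  "topspace (prerealization X) = {((n, x), t). x \<in> simplices X n \<and> t \<in> standard_simplex n}"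
  by (auto simp: prerealization_def)

lemma codegeneracy_in_standard_simplex:
  assumes "i \<le> n" "t \<in> standard_simplex (Suc n)"
  shows "codegeneracy i t \<in> standard_simplex n"
proof -
  have t: "\<And>j. 0 \<le> t j" "\<And>j. Suc n < j \<Longrightarrow> t j = 0" "(\<Sum>j\<le>Suc n. t j) = 1"
    using assms(2) by (auto simp: standard_simplex_def)
  have base: "(\<Sum>j<k. codegeneracy i t j) = (\<Sum>j<k. t j)" if "k \<le> i" for k
    using that by (intro sum.cong) (auto simp: codegeneracy_def)
  have "(\<Sum>j\<le>n. codegeneracy i t j) = (\<Sum>j\<le>Suc n. t j)"
    using assms(1)
  proof (induction n rule: dec_induct)
    case base
    show ?case
      using base[of i] by (simp add: codegeneracy_def flip: lessThan_Suc_atMost)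
  next
    case (step m)
    then show ?case by (simp add: codegeneracy_def)
  qed
  with t have sum: "(\<Sum>j\<le>n. codegeneracy i t j) = 1"
    by simp
  have nonneg: "0 \<le> codegeneracy i t j" for j
    using t(1) by (simp add: codegeneracy_def)
  have zero: "codegeneracy i t j = 0" if "n < j" for j
    using that assms(1) t(2) by (simp add: codegeneracy_def)
  have "codegeneracy i t j \<le> 1" for j
  proof (cases "j \<le> n")
    case True
    then show ?thesis
      using member_le_sum[of j "{..n}" "codegeneracy i t"] nonneg sum by simp
  qed (simp add: zero)
  with nonneg zero sum show ?thesis
    by (simp add: standard_simplex_def)
qed

lemma realization_rel_subset:
  "(p, q) \<in> realization_rel X \<Longrightarrow> simplicial_set X \<Longrightarrow>
    p \<in> topspace (prerealization X) \<and> q \<in> topspace (prerealization X)"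
proof (induction rule: realization_rel.induct)
  case (face x n i t)
  then show ?case
    using simplical_face_in_standard_simplex[of "Suc n" i t]
    by (auto simp: topspace_prerealization simplicial_set_def)
next
  case (degen x n i t)
  then show ?case
    using codegeneracy_in_standard_simplex[of i n t]
    by (auto simp: topspace_prerealization simplicial_set_def)
qed (auto simp: topspace_prerealization)

lemma equiv_realization_rel:
  assumes "simplicial_set X"
  shows "equiv (topspace (prerealization X)) (realization_rel X)"
proof (rule equivI)
  show "realization_rel X \<subseteq> topspace (prerealization X) \<times> topspace (prerealization X)"
    using realization_rel_subset[OF _ assms] by auto
  show "refl_on (topspace (prerealization X)) (realization_rel X)"
    by (auto simp: refl_on_def topspace_prerealization intro: realization_rel.refl)
  show "sym (realization_rel X)"
    by (auto simp: sym_def intro: realization_rel.sym)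
  show "trans (realization_rel X)"
    by (auto simp: trans_def intro: realization_rel.trans)
qed

lemma continuous_map_simplex_realization:
  assumes "x \<in> simplices X n"
  shows "continuous_map (subtopology (powertop_real UNIV) (standard_simplex n)) (realization X)
    (\<lambda>t. realization_rel X `` {((n, x), t)})"
proof -
  have "continuous_map (subtopology (powertop_real UNIV) (standard_simplex n)) (prerealization X)
      (\<lambda>t. ((n, x), t))"
    using assms continuous_map_component_injection[of "(n, x)" "{(n, x). x \<in> simplices X n}"
        "\<lambda>(n, x). subtopology (powertop_real UNIV) (standard_simplex n)"]
    by (simp add: prerealization_def)
  from continuous_map_compose[OF this quotient_imp_continuous_map[OF quotient_map_quotient_topology]]
  show ?thesis
    by (simp add: realization_def o_def)
qed

lemma E_sset_first_vertex:
  assumes "length ys = n" "set ys \<subseteq> S" "b \<in> S"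
  shows "(((0, [b]), \<lambda>j. if j = 0 then 1 else 0), ((n, b # ys), \<lambda>j. if j = 0 then 1 else 0))
    \<in> realization_rel (E_sset S)"
  using assms
proof (induction n arbitrary: ys)
  case 0
  then show ?case
    using realization_rel.refl[of "[b]" "E_sset S" 0 "\<lambda>j. if j = 0 then 1 else 0"]
    by (simp add: E_sset_def)
next
  case (Suc n)
  let ?e = "(\<lambda>j. if j = 0 then 1 else 0) :: nat \<Rightarrow> real"
  have "(((n, face (E_sset S) (Suc n) (Suc n) (b # ys)), ?e), ((Suc n, b # ys), simplical_face (Suc n) ?e))
      \<in> realization_rel (E_sset S)"
    using Suc.prems by (intro realization_rel.face) (auto simp: E_sset_def)
  moreover have "simplical_face (Suc n) ?e = ?e"
    by (auto simp: simplical_face_def)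
  moreover have "face (E_sset S) (Suc n) (Suc n) (b # ys) = b # take n ys"
    using Suc.prems by (simp add: E_sset_def)
  moreover have "(((0, [b]), ?e), ((n, b # take n ys), ?e)) \<in> realization_rel (E_sset S)"
    using Suc.prems by (intro Suc.IH) (auto dest: in_set_takeD)
  ultimately show ?case
    using realization_rel.trans by force
qed

lemma connected_sset_E_sset:
  assumes "S \<noteq> {}"
  shows "connected_sset (E_sset S)"
proof -
  let ?X = "E_sset S" and ?e = "(\<lambda>j. if j = 0 then 1 else 0) :: nat \<Rightarrow> real"
  obtain b where b: "b \<in> S"
    using assms by blast
  have eq: "equiv (topspace (prerealization ?X)) (realization_rel ?X)"
    by (rule equiv_realization_rel[OF simplicial_set_E_sset])
  define P where "P = (\<lambda>n xs. (\<lambda>t. realization_rel ?X `` {((Suc n, b # xs), t)}) ` standard_simplex (Suc n))"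
  have conn: "connectedin (realization ?X) (P n xs)" if "xs \<in> simplices ?X n" for n xs
  proof -
    have "b # xs \<in> simplices ?X (Suc n)"
      using that b by (auto simp: E_sset_def)
    then show ?thesis
      unfolding P_def
      by (rule connectedin_continuous_map_image[OF continuous_map_simplex_realization])
        (simp add: connectedin_subtopology connectedin_standard_simplex)
  qed
  have vertex: "vertex_point ?X [b] \<in> P n xs" if "xs \<in> simplices ?X n" for n xs
  proof -
    have "(((0, [b]), ?e), ((Suc n, b # xs), ?e)) \<in> realization_rel ?X"
      using that b by (intro E_sset_first_vertex) (auto simp: E_sset_def)
    then have "vertex_point ?X [b] = realization_rel ?X `` {((Suc n, b # xs), ?e)}"
      unfolding vertex_point_def by (rule equiv_class_eq[OF eq])
    moreover have "?e \<in> standard_simplex (Suc n)"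
      by simp
    ultimately show ?thesis
      unfolding P_def by (rule image_eqI)
  qed
  have cover: "\<exists>n xs. xs \<in> simplices ?X n \<and> c \<in> P n xs" if c: "c \<in> topspace (realization ?X)" for c
  proof -
    obtain q where "q \<in> topspace (prerealization ?X)" "c = realization_rel ?X `` {q}"
      using c unfolding realization_def topspace_quotient_topology by (blast elim: quotientE)
    then obtain n xs t where p: "xs \<in> simplices ?X n" "t \<in> standard_simplex n"
        "c = realization_rel ?X `` {((n, xs), t)}"
      by (cases q) (auto simp: topspace_prerealization)
    have "b # xs \<in> simplices ?X (Suc n)"
      using p(1) b by (auto simp: E_sset_def)
    from realization_rel.face[OF this _ p(2), of 0]
    have "(((n, xs), t), ((Suc n, b # xs), simplical_face 0 t)) \<in> realization_rel ?X"
      by (simp add: E_sset_def)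
    then have "c = realization_rel ?X `` {((Suc n, b # xs), simplical_face 0 t)}"
      unfolding p(3) by (rule equiv_class_eq[OF eq])
    moreover have "simplical_face 0 t \<in> standard_simplex (Suc n)"
      using p(2) by (intro simplical_face_in_standard_simplex) auto
    ultimately show ?thesis
      using p(1) unfolding P_def by blast
  qed
  have "topspace (realization ?X) = \<Union>{P n xs | n xs. xs \<in> simplices ?X n}"
  proof
    show "topspace (realization ?X) \<subseteq> \<Union>{P n xs | n xs. xs \<in> simplices ?X n}"
    proof
      fix c assume "c \<in> topspace (realization ?X)"
      then obtain n xs where "xs \<in> simplices ?X n" "c \<in> P n xs"
        using cover by blast
      then show "c \<in> \<Union>{P n xs | n xs. xs \<in> simplices ?X n}"
        by (intro UnionI[of "P n xs"]) auto
    qed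
    show "\<Union>{P n xs | n xs. xs \<in> simplices ?X n} \<subseteq> topspace (realization ?X)"
      by (rule Union_least) (auto dest: connectedin_subset_topspace[OF conn])
  qed
  moreover have "connectedin (realization ?X) (\<Union>{P n xs | n xs. xs \<in> simplices ?X n})"
  proof (rule connectedin_Union)
    show "connectedin (realization ?X) Q" if "Q \<in> {P n xs | n xs. xs \<in> simplices ?X n}" for Q
      using that conn by auto
    have "vertex_point ?X [b] \<in> \<Inter>{P n xs | n xs. xs \<in> simplices ?X n}"
      using vertex by auto
    then show "\<Inter>{P n xs | n xs. xs \<in> simplices ?X n} \<noteq> {}"
      by blast
  qed
  ultimately have "connected_space (realization ?X)"
    using connectedin_topspace[of "realization ?X"] by (simp only:)
  moreover have "[b] \<in> simplices ?X 0"
    using b by (simp add: E_sset_def)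
  ultimately show ?thesis
    unfolding connected_sset_def by blast
qed

end

theory Submission
  imports Defs
begin

text \<open>Fix \<open>x\<^sub>0 \<in> X\<close>. The orbit map \<open>g \<mapsto> g \<cdot> x\<^sub>0\<close> carries \<open>G\<^sub>\<chi> \<cdot> E C\<close> into \<open>G\<^sub>\<chi> \<cdot> E (C \<cdot> x\<^sub>0)\<close>. Backwards,
  given a compact \<open>K \<ni> x\<^sub>0\<close>, pick for each \<open>y \<in> G \<cdot> K\<close> some \<open>f y \<in> G\<close> with \<open>y \<in> f y \<cdot> K\<close>; by
  properness the set \<open>D\<close> of all \<open>d\<close> with \<open>d \<cdot> K\<close> meeting \<open>K\<close> is compact, and \<open>f (g \<cdot> y) \<in> g \<cdot> D\<close> for
  \<open>y \<in> K\<close>, so \<open>f\<close> carries \<open>G\<^sub>\<chi> \<cdot> E K\<close> into \<open>G\<^sub>\<chi> \<cdot> E D\<close>. Both composites move the vertices of a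
  simplex of \<open>g \<cdot> E K\<close> (or \<open>g \<cdot> E C\<close>) within \<open>g \<cdot> E L\<close> for a fixed larger compact \<open>L\<close>, so they
  are homotopic to the inclusion there, and relative to the base point once \<open>f\<close> is normalized
  at it. Hence triviality of the maps on \<open>\<pi>\<^sub>k\<close> passes from either filtration to the other.\<close>

section \<open>Maps of quotient topologies\<close>

text \<open>Maps of quotients are written without representatives: apply the map to a whole class,
  then saturate under the target relation. Related points have equivalent images and the class
  contains \<open>p\<close>, so one representative gives the value.\<close>

lemma Image_image_equiv_class:
  assumes "equiv A R" "equiv B S" "\<And>a b. (a, b) \<in> R \<Longrightarrow> (f a, f b) \<in> S" "p \<in> A"
  shows "S `` (f ` (R `` {p})) = S `` {f p}"
proof -
  have "(p, p) \<in> R"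
    using assms(1,4) by (auto simp: equiv_def refl_on_def)
  moreover have "S `` {f a} = S `` {f p}" if "(p, a) \<in> R" for a
    using equiv_class_eq[OF assms(2) assms(3)[OF that]] by simp
  ultimately show ?thesis
    by blast
qed

text \<open>The injection \<open>Pair i\<close> is open, so a neighbourhood found inside one summand
  is open in the sum. This lets a homotopy be tested one cell at a time.\<close>

lemma continuous_map_prod_sum_topology:
  assumes "\<And>i. i \<in> I \<Longrightarrow> continuous_map (prod_topology Z (X i)) Y (\<lambda>(z, x). f (z, (i, x)))"
  shows "continuous_map (prod_topology Z (sum_topology X I)) Y f"
  unfolding continuous_map_def
proof (intro conjI allI impI)
  show "f \<in> topspace (prod_topology Z (sum_topology X I)) \<rightarrow> topspace Y"
    using assms by (force simp: continuous_map_def)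
next
  fix U assume U: "openin Y U"
  show "openin (prod_topology Z (sum_topology X I))
      {p \<in> topspace (prod_topology Z (sum_topology X I)). f p \<in> U}" (is "openin _ ?W")
    unfolding openin_prod_topology_alt
  proof (intro allI impI)
    fix z p assume zp: "(z, p) \<in> ?W"
    obtain i x where p: "p = (i, x)" "i \<in> I" "x \<in> topspace (X i)"
      using zp by auto
    let ?V = "{q \<in> topspace (prod_topology Z (X i)). (case q of (z, x) \<Rightarrow> f (z, (i, x))) \<in> U}"
    have "openin (prod_topology Z (X i)) ?V"
      using assms[OF p(2)] U by (rule openin_continuous_map_preimage)
    moreover have "(z, x) \<in> ?V"
      using zp p by auto
    ultimately obtain A B where AB: "openin Z A" "openin (X i) B" "z \<in> A" "x \<in> B" "A \<times> B \<subseteq> ?V"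
      unfolding openin_prod_topology_alt by meson
    have "openin (sum_topology X I) (Pair i ` B)"
      using open_map_component_injection[OF p(2), of X] AB(2) by (simp add: open_map_def)
    moreover have "A \<times> Pair i ` B \<subseteq> ?W"
      using AB(5) p(2) by auto
    moreover have "p \<in> Pair i ` B"
      using AB(4) p(1) by simp
    ultimately show "\<exists>A B. openin Z A \<and> openin (sum_topology X I) B \<and> z \<in> A \<and> p \<in> B \<and> A \<times> B \<subseteq> ?W"
      using AB(1,3) by blast
  qed
qed

lemma continuous_map_quotient_induced:
  assumes "equiv (topspace T) R" "equiv B S"
    and rel: "\<And>a b. (a, b) \<in> R \<Longrightarrow> (f a, f b) \<in> S"
    and cont: "continuous_map T (quotient_topology T' S) (\<lambda>p. S `` {f p})"
  shows "continuous_map (quotient_topology T R) (quotient_topology T' S) (\<lambda>c. S `` (f ` c))"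
proof (rule continuous_compose_quotient_map[OF quotient_map_quotient_topology])
  show "continuous_map T (quotient_topology T' S) ((\<lambda>c. S `` (f ` c)) \<circ> (\<lambda>p. R `` {p}))"
    using cont by (rule continuous_map_eq)
      (use Image_image_equiv_class[OF assms(1,2) rel] in auto)
qed

text \<open>A quotient map times the identity of a locally compact Hausdorff space is again a
  quotient map. With the unit interval as \<open>Z\<close>, homotopies on a realization can be
  defined on representatives.\<close>

lemma continuous_map_prod_quotient_induced:
  assumes "equiv (topspace T) R" "equiv B S" "locally_compact_space Z" "Hausdorff_space Z"
    and rel: "\<And>u a b. u \<in> topspace Z \<Longrightarrow> (a, b) \<in> R \<Longrightarrow> (f u a, f u b) \<in> S"
    and cont: "continuous_map (prod_topology Z T) (quotient_topology T' S) (\<lambda>(u, p). S `` {f u p})"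
  shows "continuous_map (prod_topology Z (quotient_topology T R)) (quotient_topology T' S)
    (\<lambda>(u, c). S `` (f u ` c))"
proof (rule continuous_compose_quotient_map)
  show "quotient_map (prod_topology Z T) (prod_topology Z (quotient_topology T R))
      (\<lambda>(u, p). (u, R `` {p}))"
    using assms(3,4) quotient_map_quotient_topology by (intro quotient_map_prod_right) auto
  show "continuous_map (prod_topology Z T) (quotient_topology T' S)
      ((\<lambda>(u, c). S `` (f u ` c)) \<circ> (\<lambda>(u, p). (u, R `` {p})))"
    using cont
  proof (rule continuous_map_eq)
    fix q assume "q \<in> topspace (prod_topology Z T)"
    then obtain u p where q: "q = (u, p)" "u \<in> topspace Z" "p \<in> topspace T"
      by auto
    show "(case q of (u, p) \<Rightarrow> S `` {f u p}) =
        ((\<lambda>(u, c). S `` (f u ` c)) \<circ> (\<lambda>(u, p). (u, R `` {p}))) q"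
      using Image_image_equiv_class[OF assms(1,2) rel[OF q(2)] q(3)] q(1) by simp
  qed
qed

section \<open>Realizations of simplicial subsets of \<open>E S\<close>\<close>

lemma simplicial_subset_E_ssetD:
  assumes "simplicial_subset Y (E_sset S)"
  shows "simplicial_set Y"
    and "xs \<in> simplices Y n \<Longrightarrow> length xs = Suc n"
    and "xs \<in> simplices Y (Suc n) \<Longrightarrow> i \<le> Suc n \<Longrightarrow>
      face Y (Suc n) i xs = take i xs @ drop (Suc i) xs"
    and "xs \<in> simplices Y n \<Longrightarrow> i \<le> n \<Longrightarrow> degen Y n i xs = take (Suc i) xs @ drop i xs"
    and "xs \<in> simplices Y (Suc n) \<Longrightarrow> i \<le> Suc n \<Longrightarrow> take i xs @ drop (Suc i) xs \<in> simplices Y n"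
    and "xs \<in> simplices Y n \<Longrightarrow> i \<le> n \<Longrightarrow> take (Suc i) xs @ drop i xs \<in> simplices Y (Suc n)"
proof -
  have sub: "simplices Y n \<subseteq> simplices (E_sset S) n" for n
    using assms by (simp add: simplicial_subset_def)
  show Y: "simplicial_set Y"
    using assms by (simp add: simplicial_subset_def)
  show "xs \<in> simplices Y n \<Longrightarrow> length xs = Suc n"
    using sub[of n] by (auto simp: E_sset_def)
  show *: "face Y (Suc n) i xs = take i xs @ drop (Suc i) xs"
    if "xs \<in> simplices Y (Suc n)" "i \<le> Suc n"
    using assms that by (simp add: simplicial_subset_def E_sset_def)
  show **: "degen Y n i xs = take (Suc i) xs @ drop i xs"
    if "xs \<in> simplices Y n" "i \<le> n"
    using assms that by (simp add: simplicial_subset_def E_sset_def)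
  show "take i xs @ drop (Suc i) xs \<in> simplices Y n"
    if "xs \<in> simplices Y (Suc n)" "i \<le> Suc n"
    using Y that by (simp add: simplicial_set_def flip: *)
  show "take (Suc i) xs @ drop i xs \<in> simplices Y (Suc n)"
    if "xs \<in> simplices Y n" "i \<le> n"
    using Y that by (simp add: simplicial_set_def flip: **)
qed

lemma realization_rel_list_face:
  assumes "simplicial_subset Y (E_sset S)" "xs \<in> simplices Y (Suc n)" "i \<le> Suc n"
    and "t \<in> standard_simplex n"
  shows "(((n, take i xs @ drop (Suc i) xs), t), ((Suc n, xs), simplical_face i t)) \<in> realization_rel Y"
  using realization_rel.face[OF assms(2-4)] simplicial_subset_E_ssetD(3)[OF assms(1-3)] by simp

lemma realization_rel_list_degen:
  assumes "simplicial_subset Y (E_sset S)" "xs \<in> simplices Y n" "i \<le> n"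
    and "t \<in> standard_simplex (Suc n)"
  shows "(((Suc n, take (Suc i) xs @ drop i xs), t), ((n, xs), codegeneracy i t)) \<in> realization_rel Y"
  using realization_rel.degen[OF assms(2-4)] simplicial_subset_E_ssetD(4)[OF assms(1-3)] by simp

lemma equiv_realization_rel_list:
  "simplicial_subset Y (E_sset S) \<Longrightarrow> equiv (topspace (prerealization Y)) (realization_rel Y)"
  by (simp add: equiv_realization_rel simplicial_subset_E_ssetD(1))

lemma realization_cases:
  assumes "c \<in> topspace (realization Y)"
  obtains n xs t where "xs \<in> simplices Y n" "t \<in> standard_simplex n"
    "c = realization_rel Y `` {((n, xs), t)}"
proof -
  obtain q where "q \<in> topspace (prerealization Y)" "c = realization_rel Y `` {q}"
    using assms unfolding realization_def topspace_quotient_topology by (blast elim: quotientE)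
  then show ?thesis
    using that by (cases q) (auto simp: topspace_prerealization)
qed

text \<open>Faces and degeneracies generate the relation, so a symmetric and transitive target is
  checked on generators only. Writing these as list operations lets them pass through
  \<open>map\<close> and \<open>@\<close>.\<close>

lemma realization_rel_induct_list:
  assumes Y: "simplicial_subset Y (E_sset S)"
    and R: "sym R" "trans R"
    and refl: "\<And>n xs t. xs \<in> simplices Y n \<Longrightarrow> t \<in> standard_simplex n \<Longrightarrow>
      (f ((n, xs), t), f ((n, xs), t)) \<in> R"
    and face: "\<And>n xs i t. xs \<in> simplices Y (Suc n) \<Longrightarrow> i \<le> Suc n \<Longrightarrow> t \<in> standard_simplex n \<Longrightarrow>
      (f ((n, take i xs @ drop (Suc i) xs), t), f ((Suc n, xs), simplical_face i t)) \<in> R"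
    and degen: "\<And>n xs i t. xs \<in> simplices Y n \<Longrightarrow> i \<le> n \<Longrightarrow> t \<in> standard_simplex (Suc n) \<Longrightarrow>
      (f ((Suc n, take (Suc i) xs @ drop i xs), t), f ((n, xs), codegeneracy i t)) \<in> R"
    and "(a, b) \<in> realization_rel Y"
  shows "(f a, f b) \<in> R"
  using assms(7)
proof (induction rule: realization_rel.induct)
  case (face xs n i t)
  then show ?case
    using assms(5)[OF face(1-3)] simplicial_subset_E_ssetD(3)[OF Y face(1,2)] by simp
next
  case (degen xs n i t)
  then show ?case
    using assms(6)[OF degen(1-3)] simplicial_subset_E_ssetD(4)[OF Y degen(1,2)] by simp
qed (use R refl in \<open>auto dest: symD transD\<close>)

subsection \<open>Maps induced by vertex maps\<close>

definition push_cell :: "('a \<Rightarrow> 'b) \<Rightarrow> (nat \<times> 'a list) \<times> (nat \<Rightarrow> real) \<Rightarrow> (nat \<times> 'b list) \<times> (nat \<Rightarrow> real)"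
  where "push_cell p = (\<lambda>((n, xs), t). ((n, map p xs), t))"

definition realization_map :: "'b list sset \<Rightarrow> ('a \<Rightarrow> 'b) \<Rightarrow>
    ((nat \<times> 'a list) \<times> (nat \<Rightarrow> real)) set \<Rightarrow> ((nat \<times> 'b list) \<times> (nat \<Rightarrow> real)) set"
  where "realization_map Z p c = realization_rel Z `` (push_cell p ` c)"

text \<open>A simplicial map between subsets of some \<open>E S\<close> is determined on vertices.
  As \<open>map p\<close> commutes with deletion and doubling, the only condition left is that
  simplices go to simplices.\<close>

definition vertex_map :: "('a \<Rightarrow> 'b) \<Rightarrow> 'a list sset \<Rightarrow> 'b list sset \<Rightarrow> bool"
  where "vertex_map p Y Z \<longleftrightarrow> (\<forall>n. \<forall>xs\<in>simplices Y n. map p xs \<in> simplices Z n)"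

text \<open>Makes continuity and functoriality of vertex maps available for the inclusions of a
  filtration.\<close>

lemma realization_incl_eq_map: "realization_incl Z = realization_map Z id"
  by (auto simp: fun_eq_iff realization_incl_def realization_map_def push_cell_def)

lemma realization_rel_push_cell:
  assumes Y: "simplicial_subset Y (E_sset S)" and Z: "simplicial_subset Z (E_sset S')"
    and p: "vertex_map p Y Z" and "(a, b) \<in> realization_rel Y"
  shows "(push_cell p a, push_cell p b) \<in> realization_rel Z"
proof (rule realization_rel_induct_list[OF Y _ _ _ _ _ assms(4)])
  show "sym (realization_rel Z)" "trans (realization_rel Z)"
    using equiv_realization_rel_list[OF Z] by (auto simp: equiv_def)
  show "(push_cell p ((n, xs), t), push_cell p ((n, xs), t)) \<in> realization_rel Z"
    if "xs \<in> simplices Y n" "t \<in> standard_simplex n" for n xs t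
    using p that by (auto simp: push_cell_def vertex_map_def intro: realization_rel.refl)
  show "(push_cell p ((n, take i xs @ drop (Suc i) xs), t), push_cell p ((Suc n, xs), simplical_face i t))
      \<in> realization_rel Z"
    if "xs \<in> simplices Y (Suc n)" "i \<le> Suc n" "t \<in> standard_simplex n" for n xs i t
    using realization_rel_list_face[OF Z _ that(2,3), of "map p xs"] p that(1)
    by (simp add: push_cell_def vertex_map_def take_map drop_map)
  show "(push_cell p ((Suc n, take (Suc i) xs @ drop i xs), t), push_cell p ((n, xs), codegeneracy i t))
      \<in> realization_rel Z"
    if "xs \<in> simplices Y n" "i \<le> n" "t \<in> standard_simplex (Suc n)" for n xs i t
    using realization_rel_list_degen[OF Z _ that(2,3), of "map p xs"] p that(1)
    by (simp add: push_cell_def vertex_map_def take_map drop_map)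
qed

lemma realization_map_cell:
  assumes "simplicial_subset Y (E_sset S)" "simplicial_subset Z (E_sset S')" "vertex_map p Y Z"
    and "xs \<in> simplices Y n" "t \<in> standard_simplex n"
  shows "realization_map Z p (realization_rel Y `` {((n, xs), t)}) =
    realization_rel Z `` {((n, map p xs), t)}"
proof -
  have "((n, xs), t) \<in> topspace (prerealization Y)"
    using assms by (simp add: topspace_prerealization)
  from Image_image_equiv_class[OF equiv_realization_rel_list[OF assms(1)]
      equiv_realization_rel_list[OF assms(2)] realization_rel_push_cell[OF assms(1-3)] this]
  show ?thesis
    by (simp add: realization_map_def push_cell_def)
qed

lemma continuous_map_sum_topology:
  assumes "\<And>i. i \<in> I \<Longrightarrow> continuous_map (X i) Y (\<lambda>x. f (i, x))"
  shows "continuous_map (sum_topology X I) Y f"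
  using assms unfolding continuous_map_def openin_sum_topology by fastforce

lemma continuous_map_realization_map:
  assumes Y: "simplicial_subset Y (E_sset S)" and Z: "simplicial_subset Z (E_sset S')"
    and p: "vertex_map p Y Z"
  shows "continuous_map (realization Y) (realization Z) (realization_map Z p)"
proof -
  have "continuous_map (prerealization Y) (realization Z) (\<lambda>q. realization_rel Z `` {push_cell p q})"
    unfolding prerealization_def
    using p by (intro continuous_map_sum_topology)
      (auto simp: push_cell_def vertex_map_def intro!: continuous_map_simplex_realization)
  then show ?thesis
    using continuous_map_quotient_induced[OF equiv_realization_rel_list[OF Y]
        equiv_realization_rel_list[OF Z] realization_rel_push_cell[OF Y Z p]]
    by (simp add: realization_def realization_map_def[abs_def])
qed

lemma vertex_point_in_realization:
  assumes "v \<in> simplices Y 0"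
  shows "vertex_point Y v \<in> topspace (realization Y)"
  using assms
  by (auto simp: vertex_point_def realization_def topspace_prerealization intro!: quotientI)

lemma realization_map_vertex_point:
  assumes "simplicial_subset Y (E_sset S)" "simplicial_subset Z (E_sset S')" "vertex_map p Y Z"
    and "[v] \<in> simplices Y 0"
  shows "realization_map Z p (vertex_point Y [v]) = vertex_point Z [p v]"
  unfolding vertex_point_def using realization_map_cell[OF assms] by simp

lemma realization_map_compose:
  assumes "simplicial_subset Y (E_sset S)" "simplicial_subset Z (E_sset S')"
    and "simplicial_subset W (E_sset S'')" "vertex_map p Y Z" "vertex_map q Z W"
    and "c \<in> topspace (realization Y)"
  shows "realization_map W q (realization_map Z p c) = realization_map W (q \<circ> p) c"
proof -
  have qp: "vertex_map (q \<circ> p) Y W"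
    using assms(4,5) by (auto simp: vertex_map_def simp flip: map_map)
  obtain n xs t where c: "xs \<in> simplices Y n" "t \<in> standard_simplex n"
    "c = realization_rel Y `` {((n, xs), t)}"
    using assms(6) by (rule realization_cases)
  moreover have "map p xs \<in> simplices Z n"
    using assms(4) c(1) by (simp add: vertex_map_def)
  ultimately show ?thesis
    using assms qp by (simp add: realization_map_cell)
qed

subsection \<open>Homotopies between vertex maps\<close>

text \<open>The two copies of the \<open>n\<close>-simplex are opposite faces of a simplex of
  dimension \<open>2 * n + 1\<close>; this is the point at parameter \<open>u\<close> on the segment
  from \<open>t\<close> in the first copy to \<open>t\<close> in the second.\<close>

definition join_weights :: "nat \<Rightarrow> real \<Rightarrow> (nat \<Rightarrow> real) \<Rightarrow> nat \<Rightarrow> real"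
  where "join_weights n u t = (\<lambda>j. if j \<le> n then (1 - u) * t j else u * t (j - Suc n))"

text \<open>The straight-line homotopy from \<open>xs\<close> to \<open>map r xs\<close> inside the simplex
  \<open>xs @ map r xs\<close>, which makes a triangulation of prisms unnecessary.\<close>

definition join_cell ::
    "('a \<Rightarrow> 'a) \<Rightarrow> real \<Rightarrow> (nat \<times> 'a list) \<times> (nat \<Rightarrow> real) \<Rightarrow> (nat \<times> 'a list) \<times> (nat \<Rightarrow> real)"
  where "join_cell r u = (\<lambda>((n, xs), t). ((Suc (2 * n), xs @ map r xs), join_weights n u t))"

section \<open>Barycentric coordinates along the straight-line homotopy\<close>

lemma sum_atMost_Suc_double:
  fixes f :: "nat \<Rightarrow> real"
  shows "(\<Sum>j\<le>Suc (2 * n). f j) = (\<Sum>j\<le>n. f j) + (\<Sum>j\<le>n. f (Suc n + j))"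
proof -
  have "(\<Sum>j<a + b. f j) = (\<Sum>j<a. f j) + (\<Sum>j<b. f (a + j))" for a b
    by (induction b) (simp_all add: add.assoc)
  from this[of "Suc n" "Suc n"] show ?thesis
    by (simp only: lessThan_Suc_atMost[symmetric] mult_2 add_Suc_right add_Suc)
qed

lemma join_weights_in_standard_simplex:
  assumes "t \<in> standard_simplex n" "0 \<le> u" "u \<le> 1"
  shows "join_weights n u t \<in> standard_simplex (Suc (2 * n))"
proof -
  have t: "\<And>j. 0 \<le> t j" "\<And>j. t j \<le> 1" "\<And>j. n < j \<Longrightarrow> t j = 0" "(\<Sum>j\<le>n. t j) = 1"
    using assms(1) by (auto simp: standard_simplex_def)
  have "(\<Sum>j\<le>Suc (2 * n). join_weights n u t j) = (\<Sum>j\<le>n. (1 - u) * t j) + (\<Sum>j\<le>n. u * t j)"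
    unfolding sum_atMost_Suc_double by (simp add: join_weights_def)
  also have "\<dots> = 1"
    using t(4) by (simp flip: sum_distrib_left)
  finally have "(\<Sum>j\<le>Suc (2 * n). join_weights n u t j) = 1" .
  moreover have "0 \<le> join_weights n u t j \<and> join_weights n u t j \<le> 1" for j
    using t(1,2) assms(2,3) by (auto simp: join_weights_def intro: mult_le_one)
  moreover have "join_weights n u t j = 0" if "Suc (2 * n) < j" for j
    using that t(3)[of "j - Suc n"] by (auto simp: join_weights_def)
  ultimately show ?thesis
    by (auto simp: standard_simplex_def)
qed

text \<open>A vertex occurs in both copies, so one coface becomes two. Once a zero is inserted at
  \<open>i\<close>, the first copy has \<open>n + 2\<close> entries, which puts the second zero at
  \<open>n + 2 + i\<close>.\<close>

lemma join_weights_simplical_face: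
  assumes "i \<le> Suc n"
  shows "join_weights (Suc n) u (simplical_face i t) =
    simplical_face (Suc (Suc n) + i) (simplical_face i (join_weights n u t))"
proof
  fix j
  show "join_weights (Suc n) u (simplical_face i t) j =
    simplical_face (Suc (Suc n) + i) (simplical_face i (join_weights n u t)) j"
  proof (cases "j \<le> Suc n")
    case True
    then show ?thesis
      using assms by (auto simp: join_weights_def simplical_face_def)
  next
    case False
    then obtain m where "j = Suc (Suc n) + m"
      by (metis less_iff_Suc_add not_le add_Suc)
    then show ?thesis
      using assms by (cases m) (auto simp: join_weights_def simplical_face_def)
  qed
qed

text \<open>Coordinates are merged in both copies. The first merge shortens the first copy to
  \<open>n + 1\<close> entries, so the second takes place at \<open>n + 1 + i\<close>.\<close>

lemma join_weights_codegeneracy: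
  assumes "i \<le> n"
  shows "join_weights n u (codegeneracy i t) =
    codegeneracy (Suc n + i) (codegeneracy i (join_weights (Suc n) u t))"
proof
  fix j
  show "join_weights n u (codegeneracy i t) j =
    codegeneracy (Suc n + i) (codegeneracy i (join_weights (Suc n) u t)) j"
  proof (cases "j \<le> n")
    case True
    then show ?thesis
      using assms by (auto simp: join_weights_def codegeneracy_def distrib_left)
  next
    case False
    then obtain m where "j = Suc n + m"
      by (metis less_iff_Suc_add not_le add_Suc)
    then show ?thesis
      using assms by (auto simp: join_weights_def codegeneracy_def distrib_left)
  qed
qed

text \<open>One identification in \<open>Y\<close> becomes two in \<open>Z\<close>, one in each half
  of \<open>xs @ map r xs\<close>, linked by transitivity through an intermediate simplex
  \<open>ys\<close>.\<close>

lemma realization_rel_join_cell: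
  assumes Y: "simplicial_subset Y (E_sset S)" and Z: "simplicial_subset Z (E_sset S')"
    and r: "\<And>n xs. xs \<in> simplices Y n \<Longrightarrow> xs @ map r xs \<in> simplices Z (Suc (2 * n))"
    and u: "0 \<le> u" "u \<le> 1" and "(a, b) \<in> realization_rel Y"
  shows "(join_cell r u a, join_cell r u b) \<in> realization_rel Z"
proof (rule realization_rel_induct_list[OF Y _ _ _ _ _ assms(6)])
  show "sym (realization_rel Z)" and trans: "trans (realization_rel Z)"
    using equiv_realization_rel_list[OF Z] by (auto simp: equiv_def)
  show "(join_cell r u ((n, xs), t), join_cell r u ((n, xs), t)) \<in> realization_rel Z"
    if "xs \<in> simplices Y n" "t \<in> standard_simplex n" for n xs t
    using r[OF that(1)] join_weights_in_standard_simplex[OF that(2) u]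
    by (auto simp: join_cell_def intro: realization_rel.refl)
  show "(join_cell r u ((n, take i xs @ drop (Suc i) xs), t), join_cell r u ((Suc n, xs), simplical_face i t))
      \<in> realization_rel Z"
    if xs: "xs \<in> simplices Y (Suc n)" "i \<le> Suc n" "t \<in> standard_simplex n" for n xs i t
  proof -
    define zs where "zs = xs @ map r xs"
    \<comment> \<open>Entry \<open>i\<close> of the second half is deleted first, so that index
      \<open>i\<close> of the first half does not move.\<close>
    define ys where "ys = take (Suc (Suc n) + i) zs @ drop (Suc (Suc (Suc n) + i)) zs"
    have len: "length xs = Suc (Suc n)"
      using simplicial_subset_E_ssetD(2)[OF Y xs(1)] .
    have ys_eq: "ys = xs @ map r (take i xs @ drop (Suc i) xs)"
      using len by (simp add: ys_def zs_def take_map drop_map)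
    have del: "take i ys @ drop (Suc i) ys =
        (take i xs @ drop (Suc i) xs) @ map r (take i xs @ drop (Suc i) xs)"
      unfolding ys_eq using len xs(2) by simp
    have zs: "zs \<in> simplices Z (Suc (Suc (Suc (2 * n))))"
      using r[OF xs(1)] by (simp add: zs_def)
    have ys: "ys \<in> simplices Z (Suc (Suc (2 * n)))"
      unfolding ys_def using xs(2) by (intro simplicial_subset_E_ssetD(5)[OF Z zs]) simp
    let ?w = "join_weights n u t"
    have w: "?w \<in> standard_simplex (Suc (2 * n))"
      using xs(3) u by (rule join_weights_in_standard_simplex)
    have "(((Suc (2 * n), take i ys @ drop (Suc i) ys), ?w), ((Suc (Suc (2 * n)), ys), simplical_face i ?w))
        \<in> realization_rel Z"
      using ys w xs(2) by (intro realization_rel_list_face[OF Z]) auto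
    moreover have "simplical_face i ?w \<in> standard_simplex (Suc (Suc (2 * n)))"
      using w xs(2) by (intro simplical_face_in_standard_simplex) auto
    then have "(((Suc (Suc (2 * n)), ys), simplical_face i ?w), ((Suc (Suc (Suc (2 * n))), zs),
        simplical_face (Suc (Suc n) + i) (simplical_face i ?w))) \<in> realization_rel Z"
      unfolding ys_def using zs xs(2) by (intro realization_rel_list_face[OF Z]) auto
    ultimately have "(((Suc (2 * n), take i ys @ drop (Suc i) ys), ?w), ((Suc (Suc (Suc (2 * n))), zs),
        simplical_face (Suc (Suc n) + i) (simplical_face i ?w))) \<in> realization_rel Z"
      by (rule transD[OF trans])
    then show ?thesis
      by (simp add: join_cell_def zs_def del join_weights_simplical_face[OF xs(2)])
  qed
  show "(join_cell r u ((Suc n, take (Suc i) xs @ drop i xs), t), join_cell r u ((n, xs), codegeneracy i t))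
      \<in> realization_rel Z"
    if xs: "xs \<in> simplices Y n" "i \<le> n" "t \<in> standard_simplex (Suc n)" for n xs i t
  proof -
    define zs where "zs = xs @ map r xs"
    \<comment> \<open>Entry \<open>i\<close> of the second half, at index \<open>n + 1 + i\<close>,
      is doubled before its counterpart in the first half.\<close>
    define ys where "ys = take (Suc (Suc n + i)) zs @ drop (Suc n + i) zs"
    have len: "length xs = Suc n"
      using simplicial_subset_E_ssetD(2)[OF Y xs(1)] .
    have ys_eq: "ys = xs @ map r (take (Suc i) xs @ drop i xs)"
      using len by (simp add: ys_def zs_def take_map drop_map)
    have dup: "take (Suc i) ys @ drop i ys =
        (take (Suc i) xs @ drop i xs) @ map r (take (Suc i) xs @ drop i xs)"
      unfolding ys_eq using len xs(2) by simp
    have zs: "zs \<in> simplices Z (Suc (2 * n))"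
      using r[OF xs(1)] by (simp add: zs_def)
    have ys: "ys \<in> simplices Z (Suc (Suc (2 * n)))"
      unfolding ys_def using xs(2) by (intro simplicial_subset_E_ssetD(6)[OF Z zs]) simp
    let ?w = "join_weights (Suc n) u t"
    have w: "?w \<in> standard_simplex (Suc (Suc (Suc (2 * n))))"
      using join_weights_in_standard_simplex[OF xs(3) u] by simp
    have "(((Suc (Suc (Suc (2 * n))), take (Suc i) ys @ drop i ys), ?w), ((Suc (Suc (2 * n)), ys), codegeneracy i ?w))
        \<in> realization_rel Z"
      using ys w xs(2) by (intro realization_rel_list_degen[OF Z]) auto
    moreover have "codegeneracy i ?w \<in> standard_simplex (Suc (Suc (2 * n)))"
      using w xs(2) by (intro codegeneracy_in_standard_simplex) auto
    then have "(((Suc (Suc (2 * n)), ys), codegeneracy i ?w), ((Suc (2 * n), zs),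
        codegeneracy (Suc n + i) (codegeneracy i ?w))) \<in> realization_rel Z"
      unfolding ys_def using zs xs(2) by (intro realization_rel_list_degen[OF Z]) auto
    ultimately have "(((Suc (Suc (Suc (2 * n))), take (Suc i) ys @ drop i ys), ?w), ((Suc (2 * n), zs),
        codegeneracy (Suc n + i) (codegeneracy i ?w))) \<in> realization_rel Z"
      by (rule transD[OF trans])
    then show ?thesis
      by (simp add: join_cell_def zs_def dup join_weights_codegeneracy[OF xs(2)])
  qed
qed

text \<open>Dropping the last vertex is the last face, whose coface inserts a zero where
  \<open>t\<close> already vanishes; the weights therefore stay the same.\<close>

lemma realization_rel_append_right:
  assumes Z: "simplicial_subset Z (E_sset S)" and "length xs = Suc n"
    and "xs @ ys \<in> simplices Z (n + length ys)" "t \<in> standard_simplex n"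
  shows "(((n, xs), t), ((n + length ys, xs @ ys), t)) \<in> realization_rel Z"
  using assms(3)
proof (induction ys rule: rev_induct)
  case Nil
  then show ?case
    using assms(4) by (auto intro: realization_rel.refl)
next
  case (snoc y ys)
  let ?m = "n + length ys"
  have 1: "xs @ ys @ [y] \<in> simplices Z (Suc ?m)"
    using snoc.prems by simp
  have t: "t \<in> standard_simplex ?m"
    using assms(4) standard_simplex_mono[of n ?m] by auto
  have del: "take (Suc ?m) (xs @ ys @ [y]) @ drop (Suc (Suc ?m)) (xs @ ys @ [y]) = xs @ ys"
    using assms(2) by simp
  have "simplical_face (Suc ?m) t = t"
    using t by (auto simp: simplical_face_def standard_simplex_def)
  then have "(((?m, xs @ ys), t), ((Suc ?m, xs @ ys @ [y]), t)) \<in> realization_rel Z"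
    using realization_rel_list_face[OF Z 1 le_refl t] unfolding del by simp
  moreover have "(((n, xs), t), ((?m, xs @ ys), t)) \<in> realization_rel Z"
    using simplicial_subset_E_ssetD(5)[OF Z 1 le_refl] unfolding del by (rule snoc.IH)
  ultimately show ?case
    using realization_rel.trans by fastforce
qed

text \<open>Each prepended vertex is removed by a zeroth face, which shifts the weights by one
  place. Their membership in the standard simplex is carried through the induction because the next
  face relation needs it.\<close>

lemma realization_rel_append_left:
  assumes Z: "simplicial_subset Z (E_sset S)"
    and "ys @ xs \<in> simplices Z (length ys + n)" "t \<in> standard_simplex n"
  shows "(((n, xs), t), ((length ys + n, ys @ xs), \<lambda>j. if j < length ys then 0 else t (j - length ys)))
      \<in> realization_rel Z \<and>
    (\<lambda>j. if j < length ys then 0 else t (j - length ys)) \<in> standard_simplex (length ys + n)"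
  using assms(2)
proof (induction ys)
  case Nil
  then show ?case
    using assms(3) by (auto intro: realization_rel.refl)
next
  case (Cons y ys)
  let ?m = "length ys + n" and ?t = "\<lambda>j. if j < length ys then 0 else t (j - length ys)"
  have 1: "y # ys @ xs \<in> simplices Z (Suc ?m)"
    using Cons.prems by simp
  have mem: "ys @ xs \<in> simplices Z ?m"
    using simplicial_subset_E_ssetD(5)[OF Z 1, of 0] by simp
  note IH = Cons.IH[OF mem]
  have shift: "simplical_face 0 ?t = (\<lambda>j. if j < length (y # ys) then 0 else t (j - length (y # ys)))"
    by (auto simp: simplical_face_def fun_eq_iff less_Suc_eq_0_disj)
  have "(((?m, ys @ xs), ?t), ((Suc ?m, y # ys @ xs), simplical_face 0 ?t)) \<in> realization_rel Z"
    using realization_rel_list_face[OF Z 1 _ conjunct2[OF IH], of 0] by simp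
  then have "(((n, xs), t), ((Suc ?m, y # ys @ xs), simplical_face 0 ?t)) \<in> realization_rel Z"
    using IH realization_rel.trans by blast
  moreover have "simplical_face 0 ?t \<in> standard_simplex (Suc ?m)"
    using IH by (intro simplical_face_in_standard_simplex) auto
  ultimately show ?case
    unfolding shift by simp
qed

lemma continuous_map_join_weights:
  "continuous_map
    (prod_topology (top_of_set {0..1}) (subtopology (powertop_real UNIV) (standard_simplex n)))
    (subtopology (powertop_real UNIV) (standard_simplex (Suc (2 * n))))
    (\<lambda>(u, t). join_weights n u t)" (is "continuous_map ?P _ _")
  unfolding continuous_map_in_subtopology
proof
  have fst: "continuous_map ?P euclideanreal fst"
    using continuous_map_into_fulltopology[OF continuous_map_fst] .
  have snd: "continuous_map ?P euclideanreal (\<lambda>p. snd p j)" for j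
    using continuous_map_compose[OF continuous_map_into_fulltopology[OF continuous_map_snd]
        continuous_map_product_projection[of j UNIV]] by (simp add: o_def)
  show "continuous_map ?P (powertop_real UNIV) (\<lambda>(u, t). join_weights n u t)"
    unfolding continuous_map_componentwise_UNIV
  proof
    fix j
    show "continuous_map ?P euclideanreal (\<lambda>p. (case p of (u, t) \<Rightarrow> join_weights n u t) j)"
      using fst snd by (cases "j \<le> n") (auto simp: join_weights_def case_prod_unfold
          intro!: continuous_map_real_mult continuous_map_diff)
  qed
  show "(\<lambda>(u, t). join_weights n u t) \<in> topspace ?P \<rightarrow> standard_simplex (Suc (2 * n))"
    using join_weights_in_standard_simplex by auto
qed

text \<open>The homotopy is \<open>join_cell\<close>: at \<open>u = 0\<close> all weight lies on
  \<open>xs\<close>, at \<open>u = 1\<close> on \<open>map r xs\<close>. It fixes the base vertex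
  because the two copies of \<open>v\<close> span a degenerate edge.\<close>

lemma homotopic_realization_map:
  assumes Y: "simplicial_subset Y (E_sset S)" and Z: "simplicial_subset Z (E_sset S')"
    and r: "\<And>n xs. xs \<in> simplices Y n \<Longrightarrow> xs @ map r xs \<in> simplices Z (Suc (2 * n))"
    and v: "[v] \<in> simplices Y 0" "r v = v"
  shows "homotopic_with (\<lambda>h. h (vertex_point Y [v]) = vertex_point Z [v])
    (realization Y) (realization Z) (realization_map Z id) (realization_map Z r)"
proof -
  let ?I = "top_of_set {0..1::real}"
  let ?h = "\<lambda>(u, c). realization_rel Z `` (join_cell r u ` c)"
  \<comment> \<open>Both halves are iterated faces of a simplex of \<open>Z\<close>. Instead of
    iterating, the proof relates a test point of each half to a point of the whole; related points
    lie in the prerealization of \<open>Z\<close>.\<close>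
  have "xs \<in> simplices Z n \<and> map r xs \<in> simplices Z n" if xs: "xs \<in> simplices Y n" for n xs
  proof -
    have len: "length xs = Suc n"
      using simplicial_subset_E_ssetD(2)[OF Y xs] .
    have t: "(\<lambda>j. if j = 0 then 1 else 0) \<in> standard_simplex n"
      by simp
    show ?thesis
      using realization_rel_append_right[OF Z len _ t, of "map r xs"]
        realization_rel_append_left[OF Z _ t, of xs "map r xs"] r[OF xs]
      by (auto simp: len mult_2 topspace_prerealization
          dest: realization_rel_subset[OF _ simplicial_subset_E_ssetD(1)[OF Z]])
  qed
  then have idr: "vertex_map id Y Z" "vertex_map r Y Z"
    by (auto simp: vertex_map_def)
  have rel: "(join_cell r u a, join_cell r u b) \<in> realization_rel Z"
    if "u \<in> topspace ?I" "(a, b) \<in> realization_rel Y" for u a b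
    using realization_rel_join_cell[OF Y Z r _ _ that(2)] that(1) by simp
  have h: "realization_rel Z `` (join_cell r u ` (realization_rel Y `` {((n, xs), t)})) =
      realization_rel Z `` {((Suc (2 * n), xs @ map r xs), join_weights n u t)}"
    if "u \<in> {0..1}" "xs \<in> simplices Y n" "t \<in> standard_simplex n" for u n xs t
  proof -
    have "((n, xs), t) \<in> topspace (prerealization Y)"
      using that by (simp add: topspace_prerealization)
    from Image_image_equiv_class[OF equiv_realization_rel_list[OF Y]
        equiv_realization_rel_list[OF Z] rel this] that(1)
    show ?thesis
      by (simp add: join_cell_def)
  qed
  have cont: "continuous_map (prod_topology ?I (realization Y)) (realization Z) ?h"
    unfolding realization_def
  proof (rule continuous_map_prod_quotient_induced[OF equiv_realization_rel_list[OF Y]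
        equiv_realization_rel_list[OF Z] _ _ rel])
    show "locally_compact_space ?I"
      by (simp add: compact_imp_locally_compact_space compact_space_subtopology)
    show "Hausdorff_space ?I"
      by (simp add: Hausdorff_space_subtopology)
    show "continuous_map (prod_topology ?I (prerealization Y))
        (quotient_topology (prerealization Z) (realization_rel Z))
        (\<lambda>(u, p). realization_rel Z `` {join_cell r u p})"
      unfolding prerealization_def[of Y] realization_def[symmetric]
    proof (rule continuous_map_prod_sum_topology)
      fix i assume "i \<in> {(n, xs). xs \<in> simplices Y n}"
      then obtain n xs where i: "i = (n, xs)" "xs \<in> simplices Y n"
        by blast
      from continuous_map_compose[OF continuous_map_join_weights
          continuous_map_simplex_realization[OF r[OF i(2)]]]
      show "continuous_map
          (prod_topology ?I (case i of (n, xs) \<Rightarrow> subtopology (powertop_real UNIV) (standard_simplex n)))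
          (realization Z) (\<lambda>(u, t). case (u, (i, t)) of (u, p) \<Rightarrow> realization_rel Z `` {join_cell r u p})"
        by (simp add: i(1) o_def case_prod_unfold join_cell_def)
    qed
  qed
  have vertex: "vertex_point Y [v] \<in> topspace (realization Y)"
    by (rule vertex_point_in_realization[OF v(1)])
  show ?thesis
  proof (subst homotopic_with)
    \<comment> \<open>The endpoints may be compared on the space alone provided the property depends
      only on values there; the base vertex is a point of the space.\<close>
    show "(h (vertex_point Y [v]) = vertex_point Z [v]) = (k (vertex_point Y [v]) = vertex_point Z [v])"
      if "\<And>x. x \<in> topspace (realization Y) \<Longrightarrow> h x = k x" for h k
      using that[OF vertex] by simp
    have ends: "?h (0, c) = realization_map Z id c \<and> ?h (1, c) = realization_map Z r c"
      if c: "c \<in> topspace (realization Y)" for c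
    proof -
      from c obtain n xs t where c: "xs \<in> simplices Y n" "t \<in> standard_simplex n"
          "c = realization_rel Y `` {((n, xs), t)}"
        by (rule realization_cases)
      have len: "length xs = Suc n"
        using simplicial_subset_E_ssetD(2)[OF Y c(1)] .
      have t: "t j = 0" if "n < j" for j
        using that c(2) by (simp add: standard_simplex_def)
      have j0: "join_weights n 0 t = t"
        by (auto simp: join_weights_def fun_eq_iff t)
      have j1: "join_weights n 1 t = (\<lambda>j. if j < length xs then 0 else t (j - length xs))"
        by (auto simp: join_weights_def fun_eq_iff len)
      have "(((n, xs), t), ((Suc (2 * n), xs @ map r xs), join_weights n 0 t)) \<in> realization_rel Z"
        using realization_rel_append_right[OF Z len, of "map r xs" t] r[OF c(1)] c(2) j0
        by (simp add: len mult_2)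
      moreover have "(((n, map r xs), t), ((Suc (2 * n), xs @ map r xs), join_weights n 1 t)) \<in> realization_rel Z"
        using realization_rel_append_left[OF Z, of xs "map r xs" n t] r[OF c(1)] c(2)
        unfolding j1 by (simp add: len mult_2)
      ultimately show ?thesis
        using equiv_class_eq[OF equiv_realization_rel_list[OF Z]]
        by (simp add: c(3) h[OF _ c(1,2)] realization_map_cell[OF Y Z idr(1) c(1,2)]
            realization_map_cell[OF Y Z idr(2) c(1,2)])
    qed
    have base: "?h (u, vertex_point Y [v]) = vertex_point Z [v]" if u: "u \<in> {0..1}" for u
    proof -
      let ?e = "(\<lambda>j. if j = 0 then 1 else 0) :: nat \<Rightarrow> real"
      have vZ: "[v] \<in> simplices Z 0"
        using idr(1) v(1) by (force simp: vertex_map_def)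
      have w: "join_weights 0 u ?e \<in> standard_simplex (Suc 0)"
        using join_weights_in_standard_simplex[of ?e 0 u] u by simp
      \<comment> \<open>Collapsing the degenerate edge \<open>[v, v]\<close> adds the weights
        \<open>1 - u\<close> and \<open>u\<close>, whatever \<open>u\<close> is.\<close>
      have "codegeneracy 0 (join_weights 0 u ?e) = ?e"
        by (auto simp: codegeneracy_def join_weights_def fun_eq_iff)
      then have "(((Suc 0, [v, v]), join_weights 0 u ?e), ((0, [v]), ?e)) \<in> realization_rel Z"
        using realization_rel_list_degen[OF Z vZ le_refl w] by simp
      then have "realization_rel Z `` {((Suc 0, [v, v]), join_weights 0 u ?e)} = vertex_point Z [v]"
        unfolding vertex_point_def by (rule equiv_class_eq[OF equiv_realization_rel_list[OF Z]])
      then show ?thesis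
        using h[OF u v(1), of ?e] v(2) by (simp add: vertex_point_def)
    qed
    show "\<exists>h. continuous_map (prod_topology ?I (realization Y)) (realization Z) h \<and>
        (\<forall>c\<in>topspace (realization Y). h (0, c) = realization_map Z id c) \<and>
        (\<forall>c\<in>topspace (realization Y). h (1, c) = realization_map Z r c) \<and>
        (\<forall>u\<in>{0..1}. h (u, vertex_point Y [v]) = vertex_point Z [v])"
      by (intro exI[of _ ?h] conjI ballI cont conjunct1[OF ends] conjunct2[OF ends] base)
  qed
qed

section \<open>Essential connectedness of comparable filtrations\<close>

lemma spheroid_homotopyD:
  assumes "homotopic_with (\<lambda>h. h ` cube_boundary k \<subseteq> {y}) (cube_topology k) Y f g"
  shows "f \<in> spheroids k Y y" "g \<in> spheroids k Y y"
  using homotopic_with_imp_continuous_maps[OF assms] homotopic_with_imp_property[OF assms]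
  by (auto simp: spheroids_def)

lemma spheroid_class_eq_iff:
  assumes "f \<in> spheroids k Y y"
  shows "spheroid_class k Y y f = spheroid_class k Y y g \<longleftrightarrow>
    homotopic_with (\<lambda>h. h ` cube_boundary k \<subseteq> {y}) (cube_topology k) Y f g"
proof
  assume "spheroid_class k Y y f = spheroid_class k Y y g"
  moreover have "f \<in> spheroid_class k Y y f"
    using assms unfolding spheroid_class_def spheroids_def by (auto intro: homotopic_with_equal)
  ultimately show "homotopic_with (\<lambda>h. h ` cube_boundary k \<subseteq> {y}) (cube_topology k) Y f g"
    unfolding spheroid_class_def by (metis homotopic_with_symD mem_Collect_eq)
next
  assume "homotopic_with (\<lambda>h. h ` cube_boundary k \<subseteq> {y}) (cube_topology k) Y f g"
  then show "spheroid_class k Y y f = spheroid_class k Y y g"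
    unfolding spheroid_class_def using homotopic_with_trans homotopic_with_symD by fast
qed

lemma spheroid_compose:
  assumes "f \<in> spheroids k Y y" "continuous_map Y Z \<phi>" "\<phi> y = z"
  shows "\<phi> \<circ> f \<in> spheroids k Z z"
  using assms by (auto simp: spheroids_def intro: continuous_map_compose)

text \<open>\<open>homotopy_induced\<close> is a union over all spheroids of a class. Composition
  with \<open>\<phi>\<close> preserves homotopy, so the united classes coincide and triviality
  becomes null-homotopy of every \<open>\<phi> \<circ> f\<close>.\<close>

lemma homotopy_induced_trivial_iff:
  assumes \<phi>: "continuous_map Y Z \<phi>" "\<phi> y = z"
  shows "(\<forall>c\<in>homotopy_group k Y y. homotopy_induced k Z z \<phi> c = homotopy_one k Z z) \<longleftrightarrow>
    (\<forall>f\<in>spheroids k Y y.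
      homotopic_with (\<lambda>h. h ` cube_boundary k \<subseteq> {z}) (cube_topology k) Z (\<phi> \<circ> f) (\<lambda>t. z))"
proof -
  have "homotopy_induced k Z z \<phi> (spheroid_class k Y y f) = spheroid_class k Z z (\<phi> \<circ> f)"
    if f: "f \<in> spheroids k Y y" for f
  proof -
    have "spheroid_class k Z z (\<phi> \<circ> g) = spheroid_class k Z z (\<phi> \<circ> f)"
      if "g \<in> spheroid_class k Y y f" for g
    proof -
      have g: "homotopic_with (\<lambda>h. h ` cube_boundary k \<subseteq> {y}) (cube_topology k) Y g f"
        using that unfolding spheroid_class_def by (auto intro: homotopic_with_symD)
      then have "homotopic_with (\<lambda>h. h ` cube_boundary k \<subseteq> {z}) (cube_topology k) Z (\<phi> \<circ> g) (\<phi> \<circ> f)"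
        using \<phi> by (intro homotopic_with_compose_continuous_map_left[OF g]) auto
      then show ?thesis
        by (rule iffD2[OF spheroid_class_eq_iff[OF spheroid_compose[OF spheroid_homotopyD(1)[OF g] \<phi>]]])
    qed
    moreover have "f \<in> spheroid_class k Y y f"
      using spheroid_class_eq_iff[OF f, of f] by (auto simp: spheroid_class_def)
    ultimately show ?thesis
      unfolding homotopy_induced_def by blast
  qed
  then show ?thesis
    unfolding homotopy_group_def homotopy_one_def
    using spheroid_class_eq_iff[OF spheroid_compose[OF _ \<phi>]] by simp
qed

text \<open>Relative to the base vertex, the inclusion of \<open>Y\<close> in \<open>Z\<close> is
  homotopic to \<open>p\<close>, followed by the inclusion of \<open>Y'\<close> in
  \<open>Z'\<close>, followed by \<open>q\<close>. A spheroid thus contracts in \<open>Z\<close>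
  once its image under \<open>p\<close> contracts in \<open>Z'\<close>.\<close>

lemma homotopy_induced_trivial_factor:
  assumes YE: "simplicial_subset Y (E_sset S)" and ZE: "simplicial_subset Z (E_sset S)"
    and Y'E: "simplicial_subset Y' (E_sset S')" and Z'E: "simplicial_subset Z' (E_sset S')"
    and p: "vertex_map p Y Y'" "p v = v'" and q: "vertex_map q Z' Z" "q v' = v"
    and Y'Z': "vertex_map id Y' Z'" and v: "[v] \<in> simplices Y 0"
    and join: "\<And>n xs. xs \<in> simplices Y n \<Longrightarrow> xs @ map (q \<circ> p) xs \<in> simplices Z (Suc (2 * n))"
    and trivial: "\<forall>c\<in>homotopy_group k (realization Y') (vertex_point Y' [v']).
      homotopy_induced k (realization Z') (vertex_point Z' [v']) (realization_incl Z') c =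
      homotopy_one k (realization Z') (vertex_point Z' [v'])"
    and YZ: "vertex_map id Y Z"
  shows "\<forall>c\<in>homotopy_group k (realization Y) (vertex_point Y [v]).
      homotopy_induced k (realization Z) (vertex_point Z [v]) (realization_incl Z) c =
      homotopy_one k (realization Z) (vertex_point Z [v])"
proof -
  let ?P = "\<lambda>z h. h ` cube_boundary k \<subseteq> {z}"
  let ?y = "vertex_point Y [v]" and ?y' = "vertex_point Y' [v']"
    and ?z = "vertex_point Z [v]" and ?z' = "vertex_point Z' [v']"
  have v': "[v'] \<in> simplices Y' 0" "[v'] \<in> simplices Z' 0"
    using p v Y'Z' by (force simp: vertex_map_def)+
  have incl: "continuous_map (realization Y) (realization Z) (realization_map Z id)"
      "realization_map Z id ?y = ?z"
    using continuous_map_realization_map[OF YE ZE YZ] realization_map_vertex_point[OF YE ZE YZ v] by auto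
  have incl': "continuous_map (realization Y') (realization Z') (realization_map Z' id)"
      "realization_map Z' id ?y' = ?z'"
    using continuous_map_realization_map[OF Y'E Z'E Y'Z']
      realization_map_vertex_point[OF Y'E Z'E Y'Z' v'(1)] by auto
  have p': "continuous_map (realization Y) (realization Y') (realization_map Y' p)"
      "realization_map Y' p ?y = ?y'"
    using continuous_map_realization_map[OF YE Y'E p(1)]
      realization_map_vertex_point[OF YE Y'E p(1) v] p(2) by auto
  have q': "continuous_map (realization Z') (realization Z) (realization_map Z q)"
      "realization_map Z q ?z' = ?z"
    using continuous_map_realization_map[OF Z'E ZE q(1)]
      realization_map_vertex_point[OF Z'E ZE q(1) v'(2)] q(2) by auto
  have hom: "homotopic_with (\<lambda>h. h ?y = ?z) (realization Y) (realization Z)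
      (realization_map Z id) (realization_map Z (q \<circ> p))"
    using v p(2) q(2) by (intro homotopic_realization_map[OF YE ZE join]) auto
  have "homotopic_with (?P ?z) (cube_topology k) (realization Z) (realization_map Z id \<circ> f) (\<lambda>t. ?z)"
    if f: "f \<in> spheroids k (realization Y) ?y" for f
  proof -
    have f_cont: "continuous_map (cube_topology k) (realization Y) f" and f_bd: "?P ?y f"
      using f by (auto simp: spheroids_def)
    have "homotopic_with (?P ?z) (cube_topology k) (realization Z)
        (realization_map Z id \<circ> f) (realization_map Z (q \<circ> p) \<circ> f)"
      using f_bd by (intro homotopic_with_compose_continuous_map_right[OF hom f_cont]) auto
    moreover have "homotopic_with (?P ?z) (cube_topology k) (realization Z)
        (realization_map Z (q \<circ> p) \<circ> f) (realization_map Z q \<circ> (realization_map Z' id \<circ> (realization_map Y' p \<circ> f)))"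
    \<comment> \<open>Functoriality of \<open>realization_map\<close> is established at points of a
      realization only, so the two maps are compared on the cube and not as functions.\<close>
    proof (rule homotopic_with_equal)
      show "(realization_map Z (q \<circ> p) \<circ> f) t =
          (realization_map Z q \<circ> (realization_map Z' id \<circ> (realization_map Y' p \<circ> f))) t"
        if "t \<in> topspace (cube_topology k)" for t
      proof -
        have ft: "f t \<in> topspace (realization Y)"
          using f_cont that by (auto simp: continuous_map_def)
        have pZ': "vertex_map p Y Z'"
          using p(1) Y'Z' by (simp add: vertex_map_def)
        show ?thesis
          using realization_map_compose[OF YE Y'E Z'E p(1) Y'Z' ft]
            realization_map_compose[OF YE Z'E ZE pZ' q(1) ft] by simp
      qed
      show "?P ?z (realization_map Z (q \<circ> p) \<circ> f)"
        using f_bd homotopic_with_imp_property[OF hom] by auto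
      show "?P ?z (realization_map Z q \<circ> (realization_map Z' id \<circ> (realization_map Y' p \<circ> f)))"
        using f_bd p'(2) incl'(2) q'(2) by auto
      show "continuous_map (cube_topology k) (realization Z) (realization_map Z (q \<circ> p) \<circ> f)"
        using continuous_map_compose[OF f_cont] homotopic_with_imp_continuous_maps[OF hom] by blast
    qed
    moreover have "homotopic_with (?P ?z) (cube_topology k) (realization Z)
        (realization_map Z q \<circ> (realization_map Z' id \<circ> (realization_map Y' p \<circ> f))) (\<lambda>t. ?z)"
    proof -
      have "homotopic_with (?P ?z') (cube_topology k) (realization Z')
          (realization_map Z' id \<circ> (realization_map Y' p \<circ> f)) (\<lambda>t. ?z')"
        using trivial spheroid_compose[OF f p']
        unfolding realization_incl_eq_map homotopy_induced_trivial_iff[OF incl'] by blast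
      from homotopic_with_compose_continuous_map_left[OF this q'(1), of "?P ?z"] q'(2)
      show ?thesis
        by (simp add: o_def image_subset_iff)
    qed
    ultimately show ?thesis
      by (blast intro: homotopic_with_trans)
  qed
  then show ?thesis
    unfolding realization_incl_eq_map homotopy_induced_trivial_iff[OF incl] by blast
qed

section \<open>Comparison of two filtrations\<close>

definition prism_in :: "('a \<Rightarrow> 'a) \<Rightarrow> 'a list sset \<Rightarrow> 'a list sset \<Rightarrow> bool"
  where "prism_in r Y Z \<longleftrightarrow> (\<forall>m. \<forall>xs\<in>simplices Y m. xs @ map r xs \<in> simplices Z (Suc (2 * m)))"

text \<open>By \<open>homotopic_realization_map\<close>, these conditions make \<open>q \<circ> p\<close> homotopic to the inclusion
  of \<open>F \<alpha>\<close> into \<open>F \<beta>\<close> relative to the vertex \<open>v\<close>.\<close>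

definition retracts ::
  "'i::order set \<Rightarrow> ('i \<Rightarrow> 'a list sset) \<Rightarrow> 'i \<Rightarrow> 'a \<Rightarrow> ('a \<Rightarrow> 'b) \<Rightarrow> 'b list sset \<Rightarrow> 'b \<Rightarrow> bool"
  where "retracts A F \<alpha> v p Z' v' \<longleftrightarrow>
    (\<exists>\<beta>\<in>A. \<exists>q. \<alpha> \<le> \<beta> \<and> q v' = v \<and> vertex_map q Z' (F \<beta>) \<and> prism_in (q \<circ> p) (F \<alpha>) (F \<beta>))"

text \<open>The quantifiers follow the course of the transfer: \<open>p\<close> is fixed along with
  \<open>\<alpha>\<close>, the other filtration then answers with some \<open>\<beta>'\<close>, and
  only afterwards are \<open>\<beta>\<close> and \<open>q\<close> chosen, depending on
  \<open>\<beta>'\<close>.\<close>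

definition dominates ::
  "'j::order set \<Rightarrow> ('j \<Rightarrow> 'b list sset) \<Rightarrow> 'b \<Rightarrow> 'i::order set \<Rightarrow> ('i \<Rightarrow> 'a list sset) \<Rightarrow> 'a \<Rightarrow> bool"
  where "dominates A' F' v' A F v \<longleftrightarrow> (\<forall>\<alpha>\<in>A. [v] \<in> simplices (F \<alpha>) 0 \<longrightarrow>
    (\<exists>\<alpha>'\<in>A'. \<exists>p. p v = v' \<and> vertex_map p (F \<alpha>) (F' \<alpha>') \<and>
      (\<forall>\<beta>'\<in>A'. \<alpha>' \<le> \<beta>' \<longrightarrow> retracts A F \<alpha> v p (F' \<beta>') v')))"

text \<open>Spheroids are sent to \<open>F'\<close> by \<open>p\<close>, contracted there, and the
  contraction is brought back by \<open>q\<close>. Since \<open>ess\<close> yields an unspecified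
  base vertex \<open>v'\<close>, \<open>dom\<close> has to answer every \<open>v'\<close> with a
  suitable \<open>v\<close>.\<close>

lemma essentially_connected_transfer:
  assumes S: "connected_sset (E_sset S)" and F: "filtration A F (E_sset S)"
    and ess: "essentially_connected n A' F' (E_sset S')"
    and dom: "\<And>v'. v' \<in> S' \<Longrightarrow> \<exists>v\<in>S. dominates A' F' v' A F v"
  shows "essentially_connected n A F (E_sset S)"
proof -
  have F': "filtration A' F' (E_sset S')"
    using ess by (simp add: essentially_connected_def)
  have sub: "simplicial_subset (F \<alpha>) (E_sset S)" if "\<alpha> \<in> A" for \<alpha>
    using F that by (simp add: filtration_def)
  have sub': "simplicial_subset (F' \<alpha>) (E_sset S')" if "\<alpha> \<in> A'" for \<alpha>
    using F' that by (simp add: filtration_def)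
  have mono: "vertex_map id (F \<alpha>) (F \<beta>)" if "\<alpha> \<in> A" "\<beta> \<in> A" "\<alpha> \<le> \<beta>" for \<alpha> \<beta>
  proof -
    have "simplicial_subset (F \<alpha>) (F \<beta>)"
      using F that unfolding filtration_def by blast
    then show ?thesis
      by (auto simp: simplicial_subset_def vertex_map_def)
  qed
  have mono': "vertex_map id (F' \<alpha>) (F' \<beta>)" if "\<alpha> \<in> A'" "\<beta> \<in> A'" "\<alpha> \<le> \<beta>" for \<alpha> \<beta>
  proof -
    have "simplicial_subset (F' \<alpha>) (F' \<beta>)"
      using F' that unfolding filtration_def by blast
    then show ?thesis
      by (auto simp: simplicial_subset_def vertex_map_def)
  qed
  obtain xs where xs: "xs \<in> simplices (E_sset S') 0" and
    trivial: "\<forall>k::nat. int k \<le> n \<longrightarrow> (\<forall>\<alpha>\<in>A'. xs \<in> simplices (F' \<alpha>) 0 \<longrightarrow>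
        (\<exists>\<beta>\<in>A'. \<alpha> \<le> \<beta> \<and>
          (\<forall>c\<in>homotopy_group k (realization (F' \<alpha>)) (vertex_point (F' \<alpha>) xs).
            homotopy_induced k (realization (F' \<beta>)) (vertex_point (F' \<beta>) xs)
              (realization_incl (F' \<beta>)) c =
            homotopy_one k (realization (F' \<beta>)) (vertex_point (F' \<beta>) xs))))"
    using ess unfolding essentially_connected_def by blast
  obtain v' where v': "xs = [v']" "v' \<in> S'"
    using xs by (auto simp: E_sset_def length_Suc_conv)
  obtain v where v: "v \<in> S" and dom_v: "dominates A' F' v' A F v"
    using dom[OF v'(2)] by blast
  have "\<exists>\<beta>\<in>A. \<alpha> \<le> \<beta> \<and>
      (\<forall>c\<in>homotopy_group k (realization (F \<alpha>)) (vertex_point (F \<alpha>) [v]).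
        homotopy_induced k (realization (F \<beta>)) (vertex_point (F \<beta>) [v]) (realization_incl (F \<beta>)) c =
        homotopy_one k (realization (F \<beta>)) (vertex_point (F \<beta>) [v]))"
    if k: "int k \<le> n" and \<alpha>: "\<alpha> \<in> A" "[v] \<in> simplices (F \<alpha>) 0" for k :: nat and \<alpha>
  proof -
    obtain \<alpha>' p where \<alpha>': "\<alpha>' \<in> A'" and p: "p v = v'" "vertex_map p (F \<alpha>) (F' \<alpha>')"
      and retr: "\<forall>\<beta>'\<in>A'. \<alpha>' \<le> \<beta>' \<longrightarrow> retracts A F \<alpha> v p (F' \<beta>') v'"
      using dom_v \<alpha> unfolding dominates_def by blast
    have "xs \<in> simplices (F' \<alpha>') 0"
      using p \<alpha>(2) v'(1) by (force simp: vertex_map_def)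
    then obtain \<beta>' where \<beta>': "\<beta>' \<in> A'" "\<alpha>' \<le> \<beta>'"
      and trivial': "\<forall>c\<in>homotopy_group k (realization (F' \<alpha>')) (vertex_point (F' \<alpha>') [v']).
        homotopy_induced k (realization (F' \<beta>')) (vertex_point (F' \<beta>') [v']) (realization_incl (F' \<beta>')) c =
        homotopy_one k (realization (F' \<beta>')) (vertex_point (F' \<beta>') [v'])"
      using trivial k \<alpha>' unfolding v'(1) by blast
    obtain \<beta> q where \<beta>: "\<beta> \<in> A" "\<alpha> \<le> \<beta>" and q: "q v' = v" "vertex_map q (F' \<beta>') (F \<beta>)"
      and join: "prism_in (q \<circ> p) (F \<alpha>) (F \<beta>)"
      using retr \<beta>' unfolding retracts_def by blast
    have join': "zs @ map (q \<circ> p) zs \<in> simplices (F \<beta>) (Suc (2 * m))"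
      if "zs \<in> simplices (F \<alpha>) m" for m zs
      using join that by (simp add: prism_in_def)
    show ?thesis
      using \<beta> homotopy_induced_trivial_factor[OF sub[OF \<alpha>(1)] sub[OF \<beta>(1)] sub'[OF \<alpha>'] sub'[OF \<beta>'(1)]
          p(2,1) q(2,1) mono'[OF \<alpha>' \<beta>'] \<alpha>(2) join' trivial' mono[OF \<alpha>(1) \<beta>]]
      by (intro bexI[of _ \<beta>] conjI)
  qed
  moreover have "[v] \<in> simplices (E_sset S) 0"
    using v by (simp add: E_sset_def)
  ultimately show ?thesis
    unfolding essentially_connected_def using S F by blast
qed

section \<open>Proper actions\<close>

text \<open>All vertices of a simplex share one \<open>g\<close>. If \<open>p\<close> sends every
  point of the translate of \<open>K\<close> by \<open>g\<close> into the translate of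
  \<open>L\<close> by the same \<open>g\<close>, then images of simplices again have a common
  translating element, still in \<open>nonneg_part G chi\<close>.\<close>

lemma vertex_map_chi_sset:
  assumes "\<And>g x. g \<in> nonneg_part G chi \<Longrightarrow> x \<in> K \<Longrightarrow> \<exists>y\<in>L. p (\<phi> g x) = \<psi> g y"
  shows "vertex_map p (chi_sset G chi \<phi> K) (chi_sset G chi \<psi> L)"
  unfolding vertex_map_def
proof (intro allI ballI)
  fix n zs assume "zs \<in> simplices (chi_sset G chi \<phi> K) n"
  then obtain g xs where g: "g \<in> nonneg_part G chi" "length xs = Suc n" "set xs \<subseteq> K" "zs = map (\<phi> g) xs"
    unfolding simplices_chi_sset by blast
  then obtain c where "\<And>x. x \<in> K \<Longrightarrow> c x \<in> L \<and> p (\<phi> g x) = \<psi> g (c x)"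
    using assms[OF g(1)] by metis
  then have "map p zs = map (\<psi> g) (map c xs)" "set (map c xs) \<subseteq> L"
    using g(3,4) by auto
  then show "map p zs \<in> simplices (chi_sset G chi \<psi> L) n"
    unfolding simplices_chi_sset using g(1,2) by (metis (mono_tags, lifting) length_map mem_Collect_eq)
qed

text \<open>Both halves of the doubled list are translates by the same \<open>g\<close>, the first
  one because \<open>K \<subseteq> L\<close>.\<close>

lemma prism_in_chi_sset:
  assumes "\<And>g x. g \<in> nonneg_part G chi \<Longrightarrow> x \<in> K \<Longrightarrow> \<exists>y\<in>L. r (\<phi> g x) = \<phi> g y" and "K \<subseteq> L"
  shows "prism_in r (chi_sset G chi \<phi> K) (chi_sset G chi \<phi> L)"
  unfolding prism_in_def
proof (intro allI ballI)
  fix n zs assume "zs \<in> simplices (chi_sset G chi \<phi> K) n"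
  then obtain g xs where g: "g \<in> nonneg_part G chi" "length xs = Suc n" "set xs \<subseteq> K" "zs = map (\<phi> g) xs"
    unfolding simplices_chi_sset by blast
  then obtain c where "\<And>x. x \<in> K \<Longrightarrow> c x \<in> L \<and> r (\<phi> g x) = \<phi> g (c x)"
    using assms(1)[OF g(1)] by metis
  then have "zs @ map r zs = map (\<phi> g) (xs @ map c xs)" "set (xs @ map c xs) \<subseteq> L"
    using g(3,4) assms(2) by auto
  moreover have "length (xs @ map c xs) = Suc (Suc (2 * n))"
    using g(2) by simp
  ultimately show "zs @ map r zs \<in> simplices (chi_sset G chi \<phi> L) (Suc (2 * n))"
    unfolding simplices_chi_sset using g(1) by blast
qed

text \<open>This is the first projection of the preimage of \<open>K \<times> K\<close> under the
  map that properness is about.\<close>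

lemma compactin_return_set:
  assumes "proper_action G T X \<phi>" "compactin X K"
  shows "compactin T {g \<in> topspace T. \<exists>x\<in>K. \<phi> g x \<in> K}"
proof -
  let ?C = "{(g, x). g \<in> topspace T \<and> x \<in> topspace X \<and> (x, \<phi> g x) \<in> K \<times> K}"
  have "compactin (prod_topology T X) ?C"
    using assms compactin_Times[of X X K K] unfolding proper_action_def by blast
  then have "compactin T (fst ` ?C)"
    by (rule image_compactin) (rule continuous_map_fst)
  moreover have "fst ` ?C = {g \<in> topspace T. \<exists>x\<in>K. \<phi> g x \<in> K}"
    using compactin_subset_topspace[OF assms(2)] by (force simp: image_iff)
  ultimately show ?thesis
    by simp
qed

text \<open>If \<open>h\<close> takes \<open>r\<close> to \<open>\<phi> g y\<close>, with
  \<open>r\<close> and \<open>y\<close> in a compact \<open>L\<close>, then \<open>inv g\<close>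
  times \<open>h\<close> takes \<open>r\<close> to \<open>y\<close> and so lies in the compact
  return set of \<open>L\<close>. Any choice of \<open>h\<close> is thus close to \<open>g\<close>,
  uniformly in \<open>g\<close>.\<close>

lemma proper_action_coarse_section:
  assumes G: "topological_group G T" and \<phi>: "proper_action G T X \<phi>" and K: "compactin X K"
    and x0: "x0 \<in> topspace X" and g0: "g0 \<in> carrier G"
  obtains D f where "compactin T D" "f (\<phi> g0 x0) = g0"
    "\<And>g y. g \<in> carrier G \<Longrightarrow> y \<in> K \<Longrightarrow> \<exists>d\<in>D. f (\<phi> g y) = left_mult G g d"
proof -
  interpret topological_group G T by (rule G)
  interpret group_action G "topspace X" \<phi>
    using \<phi> by (simp add: proper_action_def continuous_action_def)
  \<comment> \<open>With \<open>x0\<close> in \<open>L\<close>, the prescribed value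
    \<open>g0\<close> at \<open>\<phi> g0 x0\<close> also takes a point of \<open>L\<close> to its
    argument, like all other values of \<open>f\<close>.\<close>
  define L where "L = insert x0 K"
  define D where "D = {d \<in> topspace T. \<exists>x\<in>L. \<phi> d x \<in> L}"
  \<comment> \<open>The first case makes \<open>f\<close> preserve base points; on points that are
    not translates of points of \<open>L\<close> the choice is arbitrary.\<close>
  define f where "f y = (if y = \<phi> g0 x0 then g0 else SOME h. h \<in> carrier G \<and> (\<exists>r\<in>L. \<phi> h r = y))" for y
  have L: "compactin X L"
    using K x0 compactin_Un[of X "{x0}" K] by (simp add: L_def)
  have LX: "L \<subseteq> topspace X"
    using L by (rule compactin_subset_topspace)
  have f: "f (\<phi> g y) \<in> carrier G \<and> (\<exists>r\<in>L. \<phi> (f (\<phi> g y)) r = \<phi> g y)"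
    if "g \<in> carrier G" "y \<in> K" for g y
  proof (cases "\<phi> g y = \<phi> g0 x0")
    case True
    then show ?thesis
      using g0 by (auto simp: f_def L_def)
  next
    case False
    have "\<exists>h. h \<in> carrier G \<and> (\<exists>r\<in>L. \<phi> h r = \<phi> g y)"
      using that by (auto simp: L_def)
    from someI_ex[OF this] show ?thesis
      using False by (simp add: f_def)
  qed
  show thesis
  proof
    show "compactin T D"
      unfolding D_def using \<phi> L by (rule compactin_return_set)
    show "f (\<phi> g0 x0) = g0"
      by (simp add: f_def)
    show "\<exists>d\<in>D. f (\<phi> g y) = left_mult G g d" if g: "g \<in> carrier G" and y: "y \<in> K" for g y
    proof
      let ?h = "f (\<phi> g y)"
      obtain r where h: "?h \<in> carrier G" and r: "r \<in> L" "\<phi> ?h r = \<phi> g y"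
        using f[OF g y] by blast
      have yL: "y \<in> L"
        using y by (simp add: L_def)
      have "\<phi> (inv\<^bsub>G\<^esub> g \<otimes>\<^bsub>G\<^esub> ?h) r = \<phi> (inv\<^bsub>G\<^esub> g) (\<phi> g y)"
        using r LX g h by (simp add: composition_rule subsetD)
      also have "\<dots> = y"
        using g yL LX by (intro orbit_sym_aux) auto
      finally show "inv\<^bsub>G\<^esub> g \<otimes>\<^bsub>G\<^esub> ?h \<in> D"
        using r(1) yL g h by (auto simp: D_def topspace_eq intro: bexI[of _ r])
      show "?h = left_mult G g (inv\<^bsub>G\<^esub> g \<otimes>\<^bsub>G\<^esub> ?h)"
        using g h by (simp add: left_mult_def flip: m_assoc)
    qed
  qed
qed

lemma compactin_orbit_image:
  assumes "continuous_action G T X \<phi>" "compactin T C" "x \<in> topspace X"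
  shows "compactin X ((\<lambda>g. \<phi> g x) ` C)"
proof (rule image_compactin[OF assms(2)])
  have "continuous_map T (prod_topology T X) (\<lambda>g. (g, x))"
    using assms(3) by (simp add: continuous_map_pairwise o_def)
  from continuous_map_compose[OF this] assms(1) show "continuous_map T X (\<lambda>g. \<phi> g x)"
    by (force simp: continuous_action_def o_def)
qed

section \<open>Mutual domination of the filtrations of \<open>E G\<close> and
  \<open>E X\<close>\<close>

theorem proposition7p2:
  fixes G :: "('g, 'm) monoid_scheme" and T :: "'g topology" and X :: "'x topology"
    and \<phi> :: "'g \<Rightarrow> 'x \<Rightarrow> 'x" and n :: nat and chi :: "'g \<Rightarrow> real"
  assumes "topological_group G T" and "locally_compact_space T" and "Hausdorff_space T"
    and "topspace X \<noteq> {}" and "locally_compact_space X" and "Hausdorff_space X"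
    and "proper_action G T X \<phi>"
    and "is_character G T chi"
  shows "chi \<in> Sigma_top G T n \<longleftrightarrow>
    essentially_connected (int n - 1) (compacts X) (chi_sset G chi \<phi>) (E_sset (topspace X))"
proof -
  interpret topological_group G T by (rule assms(1))
  interpret group_action G "topspace X" \<phi>
    using assms(7) by (simp add: proper_action_def continuous_action_def)
  note topspace_eq [simp]
  have act: "continuous_action G T X \<phi>"
    using assms(7) by (simp add: proper_action_def)
  have filt: "filtration (compacts X) (chi_sset G chi \<phi>) (E_sset (topspace X))"
    using filtration_chi_sset assms(8) group_action_axioms by blast
  have filt_G: "filtration (compacts T) (chi_sset G chi (left_mult G)) (E_sset (carrier G))"
    using filtration_chi_sset[of G T "left_mult G" T chi] group_action_left_mult[OF group_axioms]
      assms(8) by simp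
  have subT: "C \<subseteq> carrier G" if "C \<in> compacts T" for C
    using that compactin_subset_topspace[of T C] by (simp add: compacts_def)
  have orbit_map: "\<phi> (left_mult G g c) x = \<phi> g (\<phi> c x)"
    if "g \<in> nonneg_part G chi" "c \<in> carrier G" "x \<in> topspace X" for g c x
    using that by (simp add: nonneg_part_def left_mult_def composition_rule)
  have one: "\<phi> \<one>\<^bsub>G\<^esub> x = x" if "x \<in> topspace X" for x
    using that by (metis id_eq_one restrict_apply')
  have nonneg: "g \<in> carrier G" if "g \<in> nonneg_part G chi" for g
    using that by (simp add: nonneg_part_def)
  have orbit_compact: "(\<lambda>g. \<phi> g x) ` C \<in> compacts X" if "C \<in> compacts T" "x \<in> topspace X" for C x
    using compactin_orbit_image[OF act _ that(2)] that(1) by (simp add: compacts_def)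
  have Un_compact: "A \<union> B \<in> compacts U" if "A \<in> compacts U" "B \<in> compacts U"
    for A B and U :: "'c topology"
    using that by (simp add: compacts_def compactin_Un)
  show ?thesis
  proof
    assume "chi \<in> Sigma_top G T n"
    then have "essentially_connected (int n - 1) (compacts T) (chi_sset G chi (left_mult G)) (E_sset (carrier G))"
      by (simp add: Sigma_top_def)
    with connected_sset_E_sset[OF assms(4)] filt
    show "essentially_connected (int n - 1) (compacts X) (chi_sset G chi \<phi>) (E_sset (topspace X))"
    proof (rule essentially_connected_transfer)
      fix g0 assume g0: "g0 \<in> carrier G"
      obtain x0 where x0: "x0 \<in> topspace X"
        using assms(4) by blast
      \<comment> \<open>The base vertex of \<open>X\<close> is the image of \<open>g0\<close> under
        the orbit map, which will serve as \<open>q\<close>.\<close>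
      let ?v = "\<phi> g0 x0" and ?q = "\<lambda>g. \<phi> g x0"
      have "dominates (compacts T) (chi_sset G chi (left_mult G)) g0 (compacts X) (chi_sset G chi \<phi>) ?v"
        unfolding dominates_def
      proof (intro ballI impI)
        fix K assume K: "K \<in> compacts X"
        obtain D f where D: "compactin T D" and f0: "f ?v = g0"
          and f: "\<And>g y. g \<in> carrier G \<Longrightarrow> y \<in> K \<Longrightarrow> \<exists>d\<in>D. f (\<phi> g y) = left_mult G g d"
          using proper_action_coarse_section[OF assms(1,7) _ x0 g0, of K] K by (auto simp: compacts_def)
        show "\<exists>D\<in>compacts T. \<exists>p. p ?v = g0 \<and>
            vertex_map p (chi_sset G chi \<phi> K) (chi_sset G chi (left_mult G) D) \<and>
            (\<forall>D'\<in>compacts T. D \<subseteq> D' \<longrightarrow>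
              retracts (compacts X) (chi_sset G chi \<phi>) K ?v p (chi_sset G chi (left_mult G) D') g0)"
        proof (intro bexI[of _ D] exI[of _ f] conjI ballI impI f0)
          show "D \<in> compacts T"
            using D by (simp add: compacts_def)
          show "vertex_map f (chi_sset G chi \<phi> K) (chi_sset G chi (left_mult G) D)"
            using f nonneg by (intro vertex_map_chi_sset) blast
          fix D' assume D': "D' \<in> compacts T" "D \<subseteq> D'"
          \<comment> \<open>\<open>K\<close> is kept for the inclusion; the orbit image of all of
            \<open>D'\<close> receives \<open>q\<close>, and as \<open>D \<subseteq> D'\<close> it
            also contains what the composite with \<open>f\<close> produces.\<close>
          let ?K' = "K \<union> ?q ` D'"
          show "retracts (compacts X) (chi_sset G chi \<phi>) K ?v f (chi_sset G chi (left_mult G) D') g0"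
            unfolding retracts_def
          proof (intro bexI[of _ ?K'] exI[of _ ?q] conjI)
            show "?K' \<in> compacts X"
              using K orbit_compact[OF D'(1) x0] by (rule Un_compact)
            show "vertex_map ?q (chi_sset G chi (left_mult G) D') (chi_sset G chi \<phi> ?K')"
              using orbit_map[OF _ _ x0] subT[OF D'(1)] by (intro vertex_map_chi_sset) blast
            show "prism_in (?q \<circ> f) (chi_sset G chi \<phi> K) (chi_sset G chi \<phi> ?K')"
            proof (rule prism_in_chi_sset)
              fix g x assume g: "g \<in> nonneg_part G chi" and x: "x \<in> K"
              obtain d where d: "d \<in> D" "f (\<phi> g x) = left_mult G g d"
                using f[OF nonneg[OF g] x] by blast
              then show "\<exists>y\<in>?K'. (?q \<circ> f) (\<phi> g x) = \<phi> g y"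
                using orbit_map[OF g _ x0, of d] D'(2) subT[OF D'(1)] by auto
            qed auto
          qed auto
        qed
      qed
      moreover have "?v \<in> topspace X"
        using element_image g0 x0 by blast
      ultimately show "\<exists>v\<in>topspace X.
          dominates (compacts T) (chi_sset G chi (left_mult G)) g0 (compacts X) (chi_sset G chi \<phi>) v"
        by blast
    qed
  next
    assume ess: "essentially_connected (int n - 1) (compacts X) (chi_sset G chi \<phi>) (E_sset (topspace X))"
    have "carrier G \<noteq> {}"
      by auto
    from connected_sset_E_sset[OF this] filt_G ess
    have "essentially_connected (int n - 1) (compacts T) (chi_sset G chi (left_mult G)) (E_sset (carrier G))"
    proof (rule essentially_connected_transfer)
      fix x0 assume x0: "x0 \<in> topspace X"
      let ?p = "\<lambda>g. \<phi> g x0"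
      \<comment> \<open>The orbit map through \<open>x0\<close> sends the identity to
        \<open>x0\<close>, so the identity is the matching base vertex.\<close>
      have "dominates (compacts X) (chi_sset G chi \<phi>) x0 (compacts T) (chi_sset G chi (left_mult G)) \<one>\<^bsub>G\<^esub>"
        unfolding dominates_def
      proof (intro ballI impI)
        fix C assume C: "C \<in> compacts T"
        let ?K = "?p ` C"
        show "\<exists>K\<in>compacts X. \<exists>p. p \<one>\<^bsub>G\<^esub> = x0 \<and>
            vertex_map p (chi_sset G chi (left_mult G) C) (chi_sset G chi \<phi> K) \<and>
            (\<forall>L\<in>compacts X. K \<subseteq> L \<longrightarrow>
              retracts (compacts T) (chi_sset G chi (left_mult G)) C \<one>\<^bsub>G\<^esub> p (chi_sset G chi \<phi> L) x0)"
        proof (intro bexI[of _ ?K] exI[of _ ?p] conjI ballI impI one x0)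
          show "?K \<in> compacts X"
            using C x0 by (rule orbit_compact)
          show "vertex_map ?p (chi_sset G chi (left_mult G) C) (chi_sset G chi \<phi> ?K)"
            using orbit_map[OF _ _ x0] subT[OF C] by (intro vertex_map_chi_sset) blast
          fix L assume L: "L \<in> compacts X" "?K \<subseteq> L"
          \<comment> \<open>Here \<open>f\<close> plays the part of \<open>q\<close>, so it is built
            for the larger set \<open>L\<close> supplied by the filtration of \<open>E X\<close>,
            and normalized at the identity.\<close>
          obtain D f where D: "compactin T D" and f0: "f (\<phi> \<one>\<^bsub>G\<^esub> x0) = \<one>\<^bsub>G\<^esub>"
            and f: "\<And>g y. g \<in> carrier G \<Longrightarrow> y \<in> L \<Longrightarrow> \<exists>d\<in>D. f (\<phi> g y) = left_mult G g d"
            using proper_action_coarse_section[OF assms(1,7) _ x0 one_closed, of L] L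
            by (auto simp: compacts_def)
          let ?C' = "C \<union> D"
          show "retracts (compacts T) (chi_sset G chi (left_mult G)) C \<one>\<^bsub>G\<^esub> ?p (chi_sset G chi \<phi> L) x0"
            unfolding retracts_def
          proof (intro bexI[of _ ?C'] exI[of _ f] conjI)
            show "?C' \<in> compacts T"
              using C D by (intro Un_compact) (simp_all add: compacts_def)
            show "f x0 = \<one>\<^bsub>G\<^esub>"
              using f0 one[OF x0] by simp
            show "vertex_map f (chi_sset G chi \<phi> L) (chi_sset G chi (left_mult G) ?C')"
              using f nonneg by (intro vertex_map_chi_sset) blast
            show "prism_in (f \<circ> ?p) (chi_sset G chi (left_mult G) C) (chi_sset G chi (left_mult G) ?C')"
            proof (rule prism_in_chi_sset)
              fix g c assume g: "g \<in> nonneg_part G chi" and c: "c \<in> C"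
              have "\<phi> c x0 \<in> L"
                using c L(2) by blast
              then obtain d where d: "d \<in> D" "f (\<phi> g (\<phi> c x0)) = left_mult G g d"
                using f[OF nonneg[OF g]] by blast
              then show "\<exists>d\<in>?C'. (f \<circ> ?p) (left_mult G g c) = left_mult G g d"
                using orbit_map[OF g subsetD[OF subT[OF C] c] x0] by (intro bexI[of _ d]) simp_all
            qed auto
          qed auto
        qed
      qed
      then show "\<exists>v\<in>carrier G.
          dominates (compacts X) (chi_sset G chi \<phi>) x0 (compacts T) (chi_sset G chi (left_mult G)) v"
        by blast
    qed
    then show "chi \<in> Sigma_top G T n"
      using assms(8) by (simp add: Sigma_top_def)
  qed
qed

end
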